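(* Let $r$ be a reaction coordinate. The system is lumpable with respect to $r$ if and only if $\mathcal{K}_L=\mathcal{K}_\tau$, and the system is decomposable with respect to $r$ if and only if $\mathcal{T}_D=\mathcal{T}_\tau$.
   Context: Setting. $\mathbb{X}\subset\mathbb{R}^D$ is a measurable set with Lebesgue measure, $\{X_t\}_{t\ge 0}$ is a Markov process on $\mathbb{X}$, $\tau>0$ is a fixed lag time, and the transition probability function has a density $p_\tau:\mathbb{X}\times\mathbb{X}\to\mathbb{R}^+$, i.e. $\mathrm{Prob}[X_{t+\tau}\in B\mid X_t=x]=\int_B p_\tau(x,y)\,dy$ for all $x\in\mathbb{X}$ and Borel $B$. $\rho_0$ is a probability density on $\mathbb{X}$ (marginal density of $X_t$), $\rho(x,y)=\rho_0(x)p_\tau(x,y)$ is the joint density of $(X_t,X_{t+\tau})$, and $\rho_1(y)=\int_{\mathbb{X}}\rho_0(x)p_\tau(x,y)\,dx$ is the marginal density of $X_{t+\tau}$. Stationarity is not assumed. A reaction coordinate is a continuously differentiable function $r:\mathbb{X}\to\mathbb{R}^d$, $d\ll D$, such that for every $z\in\mathbb{Z}:=r(\mathbb{X})$ the level set $\{x\in\mathbb{X}: r(x)=z\}$ is a $(D-d)$-dimensional topological submanifold of $\mathbb{X}$. Lumpability: there is a function $p_\tau^L:\mathbb{Z}\times\mathbb{X}\to\mathbb{R}^+$ with $p_\tau(x,y)=p_\tau^L(r(x),y)$ for all $x,y\in\mathbb{X}$. Decomposability: there are functions $p_\tau^D:\mathbb{X}\times\mathbb{Z}\to\mathbb{R}^+$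 and $p_{\mathrm{local}}:\mathbb{Z}\times\mathbb{X}\to\mathbb{R}^+$ with $p_\tau(x,y)=p_\tau^D(x,r(y))\,p_{\mathrm{local}}(r(y),y)$ for all $x,y\in\mathbb{X}$. Transfer operators: the Koopman operator $\mathcal{K}_\tau:L^\infty(\mathbb{X})\to L^\infty(\mathbb{X})$ is $\mathcal{K}_\tau f(x)=\int_{\mathbb{X}}p_\tau(x,y)f(y)\,dy=\mathbb{E}_{(X_t,X_{t+\tau})\sim\rho}[f(X_{t+\tau})\mid X_t=x]$. The Perron–Frobenius operator $\mathcal{T}_\tau:L^1_{\rho_0}(\mathbb{X})\to L^1_{\rho_1}(\mathbb{X})$ is $\mathcal{T}_\tau u(y)=\int_{\mathbb{X}}\frac{\rho_0(x)}{\rho_1(y)}p_\tau(x,y)u(x)\,dx=\mathbb{E}_{(X_t,X_{t+\tau})\sim\rho}[u(X_t)\mid X_{t+\tau}=y]$; here $L^1_{\rho_i}(\mathbb{X})$ is the space of functions integrable with respect to $\rho_i(x)\,dx$. Reduced-order transfer operators: $\mathcal{K}_L h(x)=\mathbb{E}_{(X_t,X_{t+\tau})\sim\rho}[h(X_{t+\tau})\mid r(X_t)=r(x)]$ and $\mathcal{T}_D h(x)=\mathbb{E}_{(X_t,X_{t+\tau})\sim\rho}[h(X_t)\mid r(X_{t+\tau})=r(x)]$.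
   Formalization: "Lumpable" and "decomposable" are required of some version of the transition density, equal to p_τ(x,·) a.e. for ρ_0-almost every x, since changing p_τ on a null set breaks the literal claim; K_L=K_τ is meant ρ_0-a.e. and T_D=T_τ ρ_1-a.e. *)

theory Defs
  imports "HOL-Probability.Probability"
begin

section \<open>The process and its densities\<close>

definition natural_filtration ::
    "'w measure \<Rightarrow> (real \<Rightarrow> 'w \<Rightarrow> 'a::topological_space) \<Rightarrow> real \<Rightarrow> 'w measure" where
  "natural_filtration M X s =
     sigma (space M) {X u -` B \<inter> space M | u B. 0 \<le> u \<and> u \<le> s \<and> B \<in> sets borel}"

definition markov_process ::
    "'w measure \<Rightarrow> 'a::topological_space set \<Rightarrow> (real \<Rightarrow> 'w \<Rightarrow> 'a) \<Rightarrow> bool" where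
  "markov_process M S X \<longleftrightarrow>
     prob_space M \<and>
     (\<forall>s\<ge>0. X s \<in> measurable M (restrict_space borel S)) \<and>
     (\<forall>s\<ge>0. \<forall>u\<ge>0. \<forall>B\<in>sets borel. AE \<omega> in M.
        real_cond_exp M (natural_filtration M X s) (\<lambda>\<omega>'. indicator B (X (s + u) \<omega>')) \<omega> =
        real_cond_exp M (vimage_algebra (space M) (X s) borel)
          (\<lambda>\<omega>'. indicator B (X (s + u) \<omega>')) \<omega>)"

definition prob_density :: "'a::euclidean_space set \<Rightarrow> ('a \<Rightarrow> real) \<Rightarrow> bool" where
  "prob_density S \<rho>0 \<longleftrightarrow>
     \<rho>0 \<in> borel_measurable (lebesgue_on S) \<and> (\<forall>x\<in>S. 0 \<le> \<rho>0 x) \<and>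
     (\<integral>\<^sup>+x. ennreal (\<rho>0 x) \<partial>lebesgue_on S) = 1"

definition density_kernel :: "'a::euclidean_space set \<Rightarrow> ('a \<Rightarrow> 'a \<Rightarrow> real) \<Rightarrow> bool" where
  "density_kernel S p \<longleftrightarrow>
     (\<lambda>(x, y). p x y) \<in> borel_measurable (lebesgue_on S \<Otimes>\<^sub>M lebesgue_on S) \<and>
     (\<forall>x\<in>S. prob_density S (p x))"

text \<open>The conditional probability of \<open>X (s + \<tau>) \<in> B\<close> given \<open>X s\<close> is obtained by inserting
  \<open>X s\<close> into the transition probability \<open>x \<mapsto> \<integral>\<^sub>B p x y dy\<close>, which is the same for all \<open>s\<close>.\<close>

definition has_transition_density ::
    "'w measure \<Rightarrow> 'a::euclidean_space set \<Rightarrow> (real \<Rightarrow> 'w \<Rightarrow> 'a) \<Rightarrow> real \<Rightarrow> ('a \<Rightarrow> 'a \<Rightarrow> real) \<Rightarrow> bool" where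
  "has_transition_density M S X \<tau> p \<longleftrightarrow>
     density_kernel S p \<and>
     (\<forall>s\<ge>0. \<forall>B\<in>sets borel. AE \<omega> in M.
        real_cond_exp M (vimage_algebra (space M) (X s) borel)
          (\<lambda>\<omega>'. indicator B (X (s + \<tau>) \<omega>')) \<omega> =
        (\<integral>y. indicator B y * p (X s \<omega>) y \<partial>lebesgue_on S))"

definition has_marginal_density ::
    "'w measure \<Rightarrow> 'a::euclidean_space set \<Rightarrow> ('w \<Rightarrow> 'a) \<Rightarrow> ('a \<Rightarrow> real) \<Rightarrow> bool" where
  "has_marginal_density M S Y \<rho>0 \<longleftrightarrow>
     prob_density S \<rho>0 \<and>
     (\<forall>B\<in>sets borel. measure M (Y -` B \<inter> space M) =
        (\<integral>x. indicator B x * \<rho>0 x \<partial>lebesgue_on S))"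

definition \<rho>1 :: "'a::euclidean_space set \<Rightarrow> ('a \<Rightarrow> real) \<Rightarrow> ('a \<Rightarrow> 'a \<Rightarrow> real) \<Rightarrow> 'a \<Rightarrow> real" where
  "\<rho>1 S \<rho>0 p y = (\<integral>x. \<rho>0 x * p x y \<partial>lebesgue_on S)"

definition joint_law ::
    "'a::euclidean_space set \<Rightarrow> ('a \<Rightarrow> real) \<Rightarrow> ('a \<Rightarrow> 'a \<Rightarrow> real) \<Rightarrow> ('a \<times> 'a) measure" where
  "joint_law S \<rho>0 p =
     density (lebesgue_on S \<Otimes>\<^sub>M lebesgue_on S) (\<lambda>(x, y). ennreal (\<rho>0 x * p x y))"

text \<open>A transition density is a density of conditional laws given \<open>X\<^sub>t\<close>, hence it is only determined
  for almost every starting point with respect to the law \<open>\<rho>0 x dx\<close> of \<open>X\<^sub>t\<close>, and for those only for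
  Lebesgue-almost every end point. Lumpability and decomposability of the system mean that the
  respective pointwise factorization holds for one version of the transition density. If \<open>\<rho>0\<close> is
  positive, then versions are just the transition densities that agree Lebesgue-almost
  everywhere.\<close>

definition density_version ::
    "'a::euclidean_space set \<Rightarrow> ('a \<Rightarrow> real) \<Rightarrow> ('a \<Rightarrow> 'a \<Rightarrow> real) \<Rightarrow> ('a \<Rightarrow> 'a \<Rightarrow> real) \<Rightarrow> bool" where
  "density_version S \<rho>0 p q \<longleftrightarrow>
     density_kernel S q \<and>
     (AE x in density (lebesgue_on S) (\<lambda>x. ennreal (\<rho>0 x)). AE y in lebesgue_on S. q x y = p x y)"

section \<open>Reaction coordinates\<close>

text \<open>On a set that need not be open, the derivative is taken within the set.\<close>

definition continuously_differentiable_on ::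
    "('a::real_normed_vector \<Rightarrow> 'b::real_normed_vector) \<Rightarrow> 'a set \<Rightarrow> bool" where
  "continuously_differentiable_on r S \<longleftrightarrow>
     (\<exists>r' :: 'a \<Rightarrow> 'a \<Rightarrow>\<^sub>L 'b. (\<forall>x\<in>S. (r has_derivative blinfun_apply (r' x)) (at x within S)) \<and>
        continuous_on S r')"

text \<open>For a subset of a Euclidean space, the Hausdorff and second countability conditions hold
  automatically.\<close>

definition topological_submanifold :: "nat \<Rightarrow> 'a::euclidean_space set \<Rightarrow> bool" where
  "topological_submanifold n L \<longleftrightarrow>
     (\<forall>x\<in>L. \<exists>U V. openin (top_of_set L) U \<and> x \<in> U \<and> openin (Euclidean_space n) V \<and>
        top_of_set U homeomorphic_space subtopology (Euclidean_space n) V)"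

definition reaction_coordinate :: "(real ^ 'D) set \<Rightarrow> (real ^ 'D \<Rightarrow> real ^ 'd) \<Rightarrow> bool" where
  "reaction_coordinate S r \<longleftrightarrow>
     continuously_differentiable_on r S \<and> CARD('d) < CARD('D) \<and>
     (\<forall>z\<in>r ` S. topological_submanifold (CARD('D) - CARD('d)) {x \<in> S. r x = z})"

section \<open>Lumpability and decomposability\<close>

definition lumpable :: "'a set \<Rightarrow> ('a \<Rightarrow> 'z) \<Rightarrow> ('a \<Rightarrow> 'a \<Rightarrow> real) \<Rightarrow> bool" where
  "lumpable S r p \<longleftrightarrow>
     (\<exists>pL :: 'z \<Rightarrow> 'a \<Rightarrow> real. (\<forall>z\<in>r ` S. \<forall>y\<in>S. 0 \<le> pL z y) \<and>
        (\<forall>x\<in>S. \<forall>y\<in>S. p x y = pL (r x) y))"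

definition decomposable :: "'a set \<Rightarrow> ('a \<Rightarrow> 'z) \<Rightarrow> ('a \<Rightarrow> 'a \<Rightarrow> real) \<Rightarrow> bool" where
  "decomposable S r p \<longleftrightarrow>
     (\<exists>(pD :: 'a \<Rightarrow> 'z \<Rightarrow> real) (plocal :: 'z \<Rightarrow> 'a \<Rightarrow> real).
        (\<forall>x\<in>S. \<forall>z\<in>r ` S. 0 \<le> pD x z) \<and> (\<forall>z\<in>r ` S. \<forall>y\<in>S. 0 \<le> plocal z y) \<and>
        (\<forall>x\<in>S. \<forall>y\<in>S. p x y = pD x (r y) * plocal (r y) y))"

section \<open>Transfer operators\<close>

definition koopman ::
    "'a::euclidean_space set \<Rightarrow> ('a \<Rightarrow> 'a \<Rightarrow> real) \<Rightarrow> ('a \<Rightarrow> real) \<Rightarrow> 'a \<Rightarrow> real" where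
  "koopman S p f x = (\<integral>y. p x y * f y \<partial>lebesgue_on S)"

definition perron_frobenius ::
    "'a::euclidean_space set \<Rightarrow> ('a \<Rightarrow> real) \<Rightarrow> ('a \<Rightarrow> 'a \<Rightarrow> real) \<Rightarrow> ('a \<Rightarrow> real) \<Rightarrow> 'a \<Rightarrow> real" where
  "perron_frobenius S \<rho>0 p u y = (\<integral>x. \<rho>0 x / \<rho>1 S \<rho>0 p y * p x y * u x \<partial>lebesgue_on S)"

text \<open>The conditional expectation of \<open>f\<close> given \<open>Y = z\<close>, as a function of \<open>z\<close>. The conditional expectation
  of \<open>f\<close> given the sigma-algebra generated by \<open>Y\<close> is measurable with respect to that sigma-algebra, so it is constant on
  \<open>{Y = z}\<close> and the choice of the point there is immaterial.\<close>

definition cond_exp_at ::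
    "'w measure \<Rightarrow> ('w \<Rightarrow> real) \<Rightarrow> ('w \<Rightarrow> 'z::topological_space) \<Rightarrow> 'z \<Rightarrow> real" where
  "cond_exp_at J f Y z =
     real_cond_exp J (vimage_algebra (space J) Y borel) f (SOME \<omega>. \<omega> \<in> space J \<and> Y \<omega> = z)"

definition koopman_L ::
    "'a::euclidean_space set \<Rightarrow> ('a \<Rightarrow> real) \<Rightarrow> ('a \<Rightarrow> 'a \<Rightarrow> real) \<Rightarrow> ('a \<Rightarrow> 'z::topological_space) \<Rightarrow>
      ('a \<Rightarrow> real) \<Rightarrow> 'a \<Rightarrow> real" where
  "koopman_L S \<rho>0 p r h x = cond_exp_at (joint_law S \<rho>0 p) (\<lambda>(x0, x1). h x1) (\<lambda>(x0, x1). r x0) (r x)"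

definition perron_frobenius_D ::
    "'a::euclidean_space set \<Rightarrow> ('a \<Rightarrow> real) \<Rightarrow> ('a \<Rightarrow> 'a \<Rightarrow> real) \<Rightarrow> ('a \<Rightarrow> 'z::topological_space) \<Rightarrow>
      ('a \<Rightarrow> real) \<Rightarrow> 'a \<Rightarrow> real" where
  "perron_frobenius_D S \<rho>0 p r h x =
     cond_exp_at (joint_law S \<rho>0 p) (\<lambda>(x0, x1). h x0) (\<lambda>(x0, x1). r x1) (r x)"

definition L_infinity :: "'a::euclidean_space set \<Rightarrow> ('a \<Rightarrow> real) set" where
  "L_infinity S =
     {f \<in> borel_measurable (lebesgue_on S). \<exists>C. AE x in lebesgue_on S. \<bar>f x\<bar> \<le> C}"

definition L1_weighted :: "'a::euclidean_space set \<Rightarrow> ('a \<Rightarrow> real) \<Rightarrow> ('a \<Rightarrow> real) set" where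
  "L1_weighted S \<rho> = {u. integrable (density (lebesgue_on S) (\<lambda>x. ennreal (\<rho> x))) u}"

text \<open>Equality of operators whose values are functions modulo null sets of \<open>\<rho> x dx\<close>. A conditional
  expectation given \<open>r X\<^sub>t\<close> or \<open>r X\<^sub>t\<^sub>+\<^sub>\<tau>\<close> is only determined up to such null sets, with \<open>\<rho>\<close> the density of
  \<open>X\<^sub>t\<close> or \<open>X\<^sub>t\<^sub>+\<^sub>\<tau>\<close>, respectively.\<close>

definition operators_equal ::
    "'a::euclidean_space set \<Rightarrow> ('a \<Rightarrow> real) \<Rightarrow> ('a \<Rightarrow> real) set \<Rightarrow>
      (('a \<Rightarrow> real) \<Rightarrow> 'a \<Rightarrow> real) \<Rightarrow> (('a \<Rightarrow> real) \<Rightarrow> 'a \<Rightarrow> real) \<Rightarrow> bool" where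
  "operators_equal S \<rho> \<F> A B \<longleftrightarrow>
     (\<forall>f\<in>\<F>. AE x in density (lebesgue_on S) (\<lambda>x. ennreal (\<rho> x)). A f x = B f x)"

end

theory Submission
  imports Defs
begin

text \<open>
  Write \<open>j x y = \<rho>0 x * p x y\<close> for the joint density of \<open>(X\<^sub>t, X\<^sub>t\<^sub>+\<^sub>\<tau>)\<close>. Up to null sets, the Koopman operator is
  conditional expectation given \<open>X\<^sub>t\<close> and its reduced form is conditional expectation given \<open>r X\<^sub>t\<close>.
  The Perron-Frobenius operator and its reduced form arise in the same way after exchanging the
  two coordinates. So both equivalences are instances of one statement about a random pair
  \<open>(U, V)\<close> with joint density \<open>j\<close>: conditioning on \<open>U\<close> and on \<open>r U\<close> gives the same result for
  all functions of \<open>V\<close> if and only if \<open>j x y = a x * k (r x) y * b y\<close> almost everywhere, where \<open>a\<close>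
  and \<open>b\<close> are the marginal densities.

  If the operators agree, testing them on indicator functions yields the factorization: the law of
  \<open>(r U, V)\<close> is absolutely continuous with respect to the product of its marginals, and its
  Radon-Nikodym derivative is the factor \<open>k\<close> (\<open>law_factorizes\<close> and \<open>density_factorizes\<close>). Read
  with \<open>a = \<rho>0\<close> and \<open>b = \<rho>1\<close>, this says that \<open>p x y\<close> agrees almost everywhere with \<open>k (r x) y * \<rho>1 y\<close>,
  which is lumpability. After the exchange of coordinates it reads \<open>k (r y) x * \<rho>1 y\<close>, which is
  decomposability with local density \<open>\<rho>1\<close>. A correction on the starting points where the total
  mass is not one turns these functions into genuine transition densities (\<open>normalized_density_version\<close>).

  Conversely, lumpability or decomposability makes the full conditional expectation of every
  function a composition \<open>G \<circ> r\<close>, and then it should coincide with the reduced one. The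
  factors in the definitions of lumpability and decomposability are arbitrary functions, however,
  so that \<open>G\<close> need not be measurable, and \<open>G \<circ> r\<close> need not be measurable with respect to the
  sigma-algebra that \<open>r\<close> generates. Here continuity of \<open>r\<close> enters: a Lebesgue measurable preimage
  \<open>r -` A\<close> and its complement can be exhausted, up to null sets, by countably many
  compact sets, whose images are compact. Hence \<open>A\<close>
  lies between two Borel sets that differ by a null set of the image measure, and \<open>G\<close>
  can be replaced by a Borel function (\<open>composition_has_borel_factor\<close>).
\<close>

section \<open>Compositions with a continuous map\<close>

lemma sigma_finite_lebesgue_on:
  fixes S :: "'a::euclidean_space set"
  assumes "S \<in> sets lebesgue"
  shows "sigma_finite_measure (lebesgue_on S)"
proof (rule sigma_finite_measure_restrict_space[OF _ assms])
  show "sigma_finite_measure (lebesgue :: 'a measure)"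
  proof
    obtain A :: "nat \<Rightarrow> 'a set"
      where A: "range A \<subseteq> sets lborel" "(\<Union>i. A i) = space lborel" "\<And>i. emeasure lborel (A i) \<noteq> \<infinity>"
      using lborel.sigma_finite by blast
    then show "\<exists>C::'a set set. countable C \<and> C \<subseteq> sets lebesgue \<and> \<Union>C = space lebesgue \<and>
        (\<forall>a\<in>C. emeasure lebesgue a \<noteq> \<infinity>)"
      by (intro exI[of _ "range A"]) auto
  qed
qed

lemma lebesgue_set_almost_sigma_compact:
  fixes A :: "'a::euclidean_space set"
  assumes "A \<in> sets lebesgue"
  obtains K :: "nat \<Rightarrow> 'a set"
  where "\<And>n. compact (K n)" "(\<Union>n. K n) \<subseteq> A" "A - (\<Union>n. K n) \<in> null_sets lebesgue"
proof -
  obtain C T where C: "fsigma C" and T: "T \<in> null_sets lebesgue" "C \<union> T = A"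
    using lebesgue_set_almost_fsigma[OF assms] by metis
  obtain F :: "nat \<Rightarrow> 'a set" where F: "\<And>n. closed (F n)" "C = (\<Union>n. F n)"
    using C by (auto elim!: fsigma.cases)
  \<comment> \<open>Pieces of the countably many closed sets inside balls of all integer radii are compact.\<close>
  define K where "K n = F (fst (prod_decode n)) \<inter> cball 0 (real (snd (prod_decode n)))" for n
  have "(\<Union>n. K n) = C"
  proof (intro equalityI subsetI)
    fix x assume "x \<in> C"
    then obtain i where "x \<in> F i" using F by auto
    moreover obtain m where "norm x \<le> real m" using real_arch_simple by blast
    ultimately have "x \<in> K (prod_encode (i, m))" by (simp add: K_def)
    then show "x \<in> (\<Union>n. K n)" by blast
  qed (auto simp: K_def F)
  moreover have "compact (K n)" for n
    unfolding K_def by (intro closed_Int_compact F compact_cball)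
  moreover have "A - C \<in> null_sets lebesgue"
    by (rule null_sets_subset[OF T(1)]) (use T assms C F in auto)
  ultimately show ?thesis
    using that[of K] T(2) by auto
qed

text \<open>Both the preimage of \<open>A\<close> and its complement are, up to null sets, countable unions of compact sets.
  The images of these compact sets under \<open>r\<close> are compact, hence closed, and lie in \<open>A\<close> and in the complement
  of \<open>A\<close>, respectively. So \<open>A\<close> is enclosed between Borel sets \<open>B\<close> and \<open>C\<close> whose
  difference has a null preimage.\<close>

lemma preimage_lebesgue_imp_completion:
  fixes D :: "'a::euclidean_space set" and r :: "'a \<Rightarrow> 'b::t2_space"
  assumes D: "D \<in> sets lebesgue" and r: "continuous_on D r"
    and A: "r -` A \<inter> D \<in> sets lebesgue"
  shows "A \<in> sets (completion (distr (lebesgue_on D) borel r))"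
proof -
  have rm[measurable]: "r \<in> borel_measurable (lebesgue_on D)"
    using r D by (rule continuous_imp_measurable_on_sets_lebesgue)
  have "D - (r -` A \<inter> D) \<in> sets lebesgue" using D A by auto
  then obtain K' where K': "\<And>n::nat. compact (K' n)" "(\<Union>n. K' n) \<subseteq> D - (r -` A \<inter> D)"
    "(D - (r -` A \<inter> D)) - (\<Union>n. K' n) \<in> null_sets lebesgue"
    by (rule lebesgue_set_almost_sigma_compact) blast
  obtain K where K: "\<And>n::nat. compact (K n)" "(\<Union>n. K n) \<subseteq> r -` A \<inter> D"
    "(r -` A \<inter> D) - (\<Union>n. K n) \<in> null_sets lebesgue"
    using A by (rule lebesgue_set_almost_sigma_compact) blast
  have im: "(\<Union>n. r ` L n) \<in> sets borel" if "\<And>n::nat. compact (L n)" "(\<Union>n. L n) \<subseteq> D" for L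
  proof -
    have "compact (r ` L n)" for n
      using that by (intro compact_continuous_image continuous_on_subset[OF r]) auto
    then show ?thesis by (intro sets.countable_UN) (auto intro: borel_closed compact_imp_closed)
  qed
  define B where "B = (\<Union>n. r ` K n)"
  define C where "C = UNIV - (\<Union>n. r ` K' n)"
  have B[measurable]: "B \<in> sets borel" unfolding B_def using K by (intro im) auto
  have C[measurable]: "C \<in> sets borel" unfolding C_def using K' by (intro sets.Diff im) auto
  have "B \<subseteq> A" using K(2) by (auto simp: B_def)
  have "A \<subseteq> C" using K'(2) by (auto simp: C_def)
  have "C - B \<in> null_sets (distr (lebesgue_on D) borel r)"
  proof -
    have "r -` (C - B) \<inter> D \<subseteq> ((D - (r -` A \<inter> D)) - (\<Union>n. K' n)) \<union> ((r -` A \<inter> D) - (\<Union>n. K n))"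
      by (auto simp: B_def C_def)
    moreover have "r -` (C - B) \<inter> space (lebesgue_on D) \<in> sets (lebesgue_on D)" by measurable
    then have "r -` (C - B) \<inter> D \<in> sets lebesgue"
      using D by (auto simp: sets_restrict_space_iff)
    ultimately have "r -` (C - B) \<inter> D \<in> null_sets lebesgue"
      by (meson K(3) K'(3) null_sets.Un null_sets_subset)
    then show ?thesis
      using D by (auto simp: null_sets_def emeasure_distr emeasure_restrict_space)
  qed
  moreover have "A - B \<subseteq> C - B" using \<open>A \<subseteq> C\<close> by auto
  ultimately show ?thesis
    unfolding sets_completion using \<open>B \<subseteq> A\<close>
    by (intro completionI[of A B "A - B" "C - B"]) auto
qed

text \<open>The factor \<open>G\<close> is an arbitrary function. The equation holds on a measurable set
  \<open>D\<close> that exhausts \<open>{x. 0 < a x}\<close> up to a null set, and on \<open>D\<close> the preimages of Borel sets under \<open>G \<circ> r\<close> are Lebesgue measurable. So \<open>G\<close> is measurable for the completion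
  of the image of Lebesgue measure on \<open>D\<close> under \<open>r\<close>, and it equals a Borel function almost everywhere for
  this image measure.\<close>

lemma composition_has_borel_factor:
  fixes S :: "'a::euclidean_space set" and r :: "'a \<Rightarrow> 'b::t2_space" and g :: "'a \<Rightarrow> real"
  assumes S: "S \<in> sets lebesgue" and r: "continuous_on S r"
    and [measurable]: "g \<in> borel_measurable (lebesgue_on S)" "a \<in> borel_measurable (lebesgue_on S)"
    and eq: "AE x in density (lebesgue_on S) a. g x = G (r x)"
  obtains G' where "G' \<in> borel_measurable borel" "AE x in density (lebesgue_on S) a. g x = G' (r x)"
proof -
  have "AE x in lebesgue_on S. 0 < a x \<longrightarrow> g x = G (r x)"
    using eq by (simp add: AE_density)
  then obtain Z where Z: "{x \<in> S. \<not> (0 < a x \<longrightarrow> g x = G (r x))} \<subseteq> Z"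
    "Z \<in> null_sets (lebesgue_on S)"
    by (auto simp: eventually_ae_filter)
  have [measurable]: "Z \<in> sets (lebesgue_on S)" using Z by auto
  define D where "D = {x \<in> space (lebesgue_on S). 0 < a x} - Z"
  have DS: "D \<subseteq> S" by (auto simp: D_def)
  have Dm: "D \<in> sets (lebesgue_on S)" unfolding D_def by measurable
  then have D: "D \<in> sets lebesgue"
    using S by (auto simp: sets_restrict_space_iff)
  have gD: "g x = G (r x)" if "x \<in> D" for x using that Z by (auto simp: D_def)
  have gm[measurable]: "g \<in> borel_measurable (lebesgue_on D)"
    using measurable_restrict_mono[of g lebesgue S borel D] DS by simp
  have rD: "continuous_on D r" by (rule continuous_on_subset[OF r DS])
  have [measurable]: "r \<in> borel_measurable (lebesgue_on D)"
    using rD D by (rule continuous_imp_measurable_on_sets_lebesgue)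
  let ?\<mu> = "distr (lebesgue_on D) borel r"
  have "G \<in> borel_measurable (completion ?\<mu>)"
  proof (rule measurableI)
    fix B :: "real set" assume [measurable]: "B \<in> sets borel"
    have "g -` B \<inter> space (lebesgue_on D) \<in> sets (lebesgue_on D)" by measurable
    moreover have "r -` (G -` B) \<inter> D = g -` B \<inter> space (lebesgue_on D)"
      using gD by auto
    ultimately have "r -` (G -` B) \<inter> D \<in> sets lebesgue"
      using D by (auto simp: sets_restrict_space_iff)
    then have "G -` B \<in> sets (completion ?\<mu>)"
      by (rule preimage_lebesgue_imp_completion[OF D rD])
    then show "G -` B \<inter> space (completion ?\<mu>) \<in> sets (completion ?\<mu>)"
      by (simp only: space_completion space_distr space_borel Int_UNIV_right)
  qed simp
  then obtain G' where G': "G' \<in> borel_measurable ?\<mu>" "AE z in ?\<mu>. G z = G' z"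
    by (blast dest: completion_ex_borel_measurable_real)
  have "AE x in lebesgue_on D. G (r x) = G' (r x)"
    by (rule AE_distrD[OF _ G'(2)]) simp
  then have "AE x in lebesgue. x \<in> D \<longrightarrow> G (r x) = G' (r x)"
    using D by (simp add: AE_restrict_space_iff)
  then have "AE x in lebesgue_on S. x \<in> D \<longrightarrow> G (r x) = G' (r x)"
    using S by (auto simp: AE_restrict_space_iff elim!: eventually_mono)
  then have "AE x in lebesgue_on S. 0 < a x \<longrightarrow> g x = G' (r x)"
    using AE_not_in[OF Z(2)] AE_space by eventually_elim (use gD in \<open>auto simp: D_def\<close>)
  then have "AE x in density (lebesgue_on S) a. g x = G' (r x)"
    by (simp add: AE_density)
  with G'(1) show ?thesis using that by auto
qed

section \<open>Conditioning on a function of a random element\<close>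

lemma measure_eqI_Times:
  assumes sP: "sets P = sets (N \<Otimes>\<^sub>M N')" and sQ: "sets Q = sets (N \<Otimes>\<^sub>M N')"
    and fin: "finite_measure P"
    and eq: "\<And>A B. A \<in> sets N \<Longrightarrow> B \<in> sets N' \<Longrightarrow> emeasure P (A \<times> B) = emeasure Q (A \<times> B)"
  shows "P = Q"
proof (rule measure_eqI_generator_eq[OF Int_stable_pair_measure_generator[of N N']])
  show "{a \<times> b |a b. a \<in> sets N \<and> b \<in> sets N'} \<subseteq> Pow (space N \<times> space N')"
    using sets.space_closed[of N] sets.space_closed[of N'] by auto
  show "sets P = sigma_sets (space N \<times> space N') {a \<times> b |a b. a \<in> sets N \<and> b \<in> sets N'}"
    "sets Q = sigma_sets (space N \<times> space N') {a \<times> b |a b. a \<in> sets N \<and> b \<in> sets N'}"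
    using sP sQ by (simp_all add: sets_pair_measure)
  show "range (\<lambda>_::nat. space N \<times> space N') \<subseteq> {a \<times> b |a b. a \<in> sets N \<and> b \<in> sets N'}"
    by auto
  show "emeasure P (space N \<times> space N') \<noteq> \<infinity>"
    using fin by (simp add: finite_measure.emeasure_finite)
qed (use eq in auto)

text \<open>A function measurable for the sigma-algebra generated by \<open>Y\<close> is constant on the fibres of
  \<open>Y\<close>, because singletons of reals are Borel sets. This removes the choice
  operator from \<open>cond_exp_at\<close>.\<close>

lemma cond_exp_at_eq_real_cond_exp:
  assumes "\<omega> \<in> space J"
  shows "cond_exp_at J f Y (Y \<omega>) = real_cond_exp J (vimage_algebra (space J) Y borel) f \<omega>"
proof -
  let ?F = "vimage_algebra (space J) Y borel"
  let ?c = "real_cond_exp J ?F f"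
  define \<omega>' where "\<omega>' = (SOME \<omega>'. \<omega>' \<in> space J \<and> Y \<omega>' = Y \<omega>)"
  have \<omega>': "\<omega>' \<in> space J" "Y \<omega>' = Y \<omega>"
    using someI[of "\<lambda>\<omega>'. \<omega>' \<in> space J \<and> Y \<omega>' = Y \<omega>" \<omega>] assms by (auto simp: \<omega>'_def)
  have "?c -` {?c \<omega>} \<inter> space ?F \<in> sets ?F"
    by (rule measurable_sets[OF borel_measurable_cond_exp]) simp
  then obtain B where "?c -` {?c \<omega>} \<inter> space J = Y -` B \<inter> space J"
    by (auto simp: sets_vimage_algebra2)
  with assms \<omega>' have "?c \<omega>' = ?c \<omega>"
    by (metis (no_types, lifting) IntE IntI singletonD singletonI vimage_eq)
  then show ?thesis
    by (simp add: cond_exp_at_def \<omega>'_def)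
qed

text \<open>Surjectivity of \<open>U\<close> lets statements about almost every outcome be read as statements about
  almost every point of \<open>N\<close> without measurability of the exceptional set.\<close>

locale reduced_conditioning = prob_space J for J :: "'w measure" +
  fixes N :: "'a measure" and N' :: "'b measure"
    and U :: "'w \<Rightarrow> 'a" and V :: "'w \<Rightarrow> 'b" and r :: "'a \<Rightarrow> 'z::topological_space"
  assumes U[measurable]: "U \<in> J \<rightarrow>\<^sub>M N" and V[measurable]: "V \<in> J \<rightarrow>\<^sub>M N'"
    and r[measurable]: "r \<in> borel_measurable N"
    and surj: "space N \<subseteq> U ` space J"
begin

definition reduced :: "('b \<Rightarrow> real) \<Rightarrow> 'a \<Rightarrow> real" where
  "reduced f x = cond_exp_at J (\<lambda>\<omega>. f (V \<omega>)) (\<lambda>\<omega>. r (U \<omega>)) (r x)"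

text \<open>The function \<open>g\<close> represents the conditional expectation of \<open>f V\<close> given \<open>U\<close>, as a function of the
  value of \<open>U\<close>.\<close>

definition full_version :: "('b \<Rightarrow> real) \<Rightarrow> ('a \<Rightarrow> real) \<Rightarrow> bool" where
  "full_version f g \<longleftrightarrow> integrable (distr J N U) g \<and>
     (\<forall>A\<in>sets N. (\<integral>\<omega>. indicator A (U \<omega>) * f (V \<omega>) \<partial>J) = (\<integral>x. indicator A x * g x \<partial>distr J N U))"

text \<open>The characterization of conditional expectations, transported to the values of \<open>U\<close>. The
  exceptional set is measurable for the sigma-algebra generated by \<open>r U\<close>, so it is the preimage of a Borel
  set \<open>B\<close>, and \<open>r -` B\<close> is a null set for the law of \<open>U\<close>.\<close>

lemma reduced_eq_factor:
  fixes G :: "'z \<Rightarrow> real"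
  assumes f: "integrable J (\<lambda>\<omega>. f (V \<omega>))"
    and G[measurable]: "G \<in> borel_measurable borel"
    and Gi: "integrable (distr J N U) (\<lambda>x. G (r x))"
    and eq: "\<And>B. B \<in> sets borel \<Longrightarrow>
      (\<integral>\<omega>. indicator B (r (U \<omega>)) * f (V \<omega>) \<partial>J) = (\<integral>x. indicator B (r x) * G (r x) \<partial>distr J N U)"
  shows "AE x in distr J N U. reduced f x = G (r x)"
proof -
  let ?Y = "\<lambda>\<omega>. r (U \<omega>)"
  let ?F = "vimage_algebra (space J) ?Y borel"
  let ?c = "real_cond_exp J ?F (\<lambda>\<omega>. f (V \<omega>))"
  have setsF: "sets ?F = {?Y -` B \<inter> space J | B. B \<in> sets borel}"
    by (rule sets_vimage_algebra2) simp
  interpret finite_measure_subalgebra J ?F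
    by unfold_locales (auto simp: subalgebra_def setsF)
  have YF: "?Y \<in> borel_measurable ?F"
    by (rule measurable_vimage_algebra1) simp
  have GF[measurable]: "(\<lambda>\<omega>. G (?Y \<omega>)) \<in> borel_measurable ?F"
    by (rule measurable_compose[OF YF G])
  have AE_c: "AE \<omega> in J. ?c \<omega> = G (?Y \<omega>)"
  proof (rule real_cond_exp_charact(1))
    fix A assume "A \<in> sets ?F"
    then obtain B where B[measurable]: "B \<in> sets borel" and A: "A = ?Y -` B \<inter> space J"
      by (auto simp: setsF)
    have "(\<integral>\<omega>\<in>A. f (V \<omega>) \<partial>J) = (\<integral>\<omega>. indicator B (?Y \<omega>) * f (V \<omega>) \<partial>J)"
      unfolding set_lebesgue_integral_def
      by (rule Bochner_Integration.integral_cong) (auto simp: A indicator_def)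
    also have "\<dots> = (\<integral>\<omega>. indicator B (?Y \<omega>) * G (?Y \<omega>) \<partial>J)"
      by (simp add: eq[OF B] integral_distr)
    also have "\<dots> = (\<integral>\<omega>\<in>A. G (?Y \<omega>) \<partial>J)"
      unfolding set_lebesgue_integral_def
      by (rule Bochner_Integration.integral_cong) (auto simp: A indicator_def)
    finally show "(\<integral>\<omega>\<in>A. f (V \<omega>) \<partial>J) = (\<integral>\<omega>\<in>A. G (?Y \<omega>) \<partial>J)" .
  next
    show "integrable J (\<lambda>\<omega>. G (?Y \<omega>))"
      using Gi by (subst (asm) integrable_distr_eq) auto
  qed (use f in auto)
  have "{\<omega> \<in> space ?F. ?c \<omega> \<noteq> G (?Y \<omega>)} \<in> sets ?F"
    by measurable
  then obtain B where B[measurable]: "B \<in> sets borel"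
    and bad: "{\<omega> \<in> space J. ?c \<omega> \<noteq> G (?Y \<omega>)} = ?Y -` B \<inter> space J"
    unfolding setsF by auto
  have "AE \<omega> in J. ?Y \<omega> \<notin> B"
    using AE_c AE_space by eventually_elim (use bad in auto)
  then have "AE x in distr J N U. r x \<notin> B"
    by (subst AE_distr_iff) auto
  then show ?thesis
    using AE_space
  proof eventually_elim
    case (elim x)
    then obtain \<omega> where \<omega>: "\<omega> \<in> space J" "x = U \<omega>"
      using surj by auto
    have "reduced f x = ?c \<omega>"
      unfolding reduced_def \<omega>(2) by (rule cond_exp_at_eq_real_cond_exp[OF \<omega>(1)])
    with elim bad \<omega> show ?case by auto
  qed
qed

text \<open>If the conditional expectation given \<open>U\<close> is already a Borel function of \<open>r U\<close>, then by the tower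
  property it is the conditional expectation given \<open>r U\<close>.\<close>

lemma reduced_eq_full_version:
  assumes f: "integrable J (\<lambda>\<omega>. f (V \<omega>))" and g: "full_version f g"
    and G[measurable]: "G \<in> borel_measurable borel"
    and eq: "AE x in distr J N U. g x = G (r x)"
  shows "AE x in distr J N U. reduced f x = g x"
proof -
  have gi: "integrable (distr J N U) g" using g by (simp add: full_version_def)
  have [measurable]: "g \<in> borel_measurable N" using gi by auto
  have "integrable (distr J N U) (\<lambda>x. G (r x))"
    using gi eq by (subst integrable_cong_AE[where g=g]) auto
  moreover have "(\<integral>\<omega>. indicator B (r (U \<omega>)) * f (V \<omega>) \<partial>J) = (\<integral>x. indicator B (r x) * G (r x) \<partial>distr J N U)"
    if [measurable]: "B \<in> sets borel" for B
  proof -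
    have "(\<integral>\<omega>. indicator B (r (U \<omega>)) * f (V \<omega>) \<partial>J) = (\<integral>\<omega>. indicator (r -` B \<inter> space N) (U \<omega>) * f (V \<omega>) \<partial>J)"
      by (rule Bochner_Integration.integral_cong) (auto simp: indicator_def dest: measurable_space[OF U])
    also have "\<dots> = (\<integral>x. indicator (r -` B \<inter> space N) x * g x \<partial>distr J N U)"
      using g by (auto simp: full_version_def)
    also have "\<dots> = (\<integral>x. indicator B (r x) * G (r x) \<partial>distr J N U)"
    proof (rule integral_cong_AE)
      show "AE x in distr J N U. indicator (r -` B \<inter> space N) x * g x = indicator B (r x) * G (r x)"
        using eq AE_space by eventually_elim (auto simp: indicator_def)
    qed auto
    finally show ?thesis .
  qed
  ultimately have "AE x in distr J N U. reduced f x = G (r x)"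
    by (intro reduced_eq_factor f) auto
  with eq show ?thesis by eventually_elim auto
qed


text \<open>The factor \<open>k\<close> is the density of the law of \<open>(r U, V)\<close> with respect to the product of its marginals,
  which exists because absolute continuity passes to images. Integrating \<open>k (z, y)\<close> over
  \<open>y \<in> A'\<close> yields a Borel function of \<open>z\<close>, which is the conditional probability of \<open>V \<in> A'\<close> given \<open>r U = z\<close>. By
  assumption it is also the conditional probability given \<open>U\<close>, so the law of \<open>(U, V)\<close> agrees on
  rectangles with the measure of density \<open>k (r x, y)\<close>.\<close>

lemma law_factorizes:
  assumes ac: "absolutely_continuous (distr J N U \<Otimes>\<^sub>M distr J N' V)
      (distr J (N \<Otimes>\<^sub>M N') (\<lambda>\<omega>. (U \<omega>, V \<omega>)))"
    and red: "\<And>A. A \<in> sets N' \<Longrightarrow>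
      \<exists>g. full_version (indicator A) g \<and> (AE x in distr J N U. reduced (indicator A) x = g x)"
  obtains k :: "'z \<times> 'b \<Rightarrow> ennreal"
  where "k \<in> borel_measurable (borel \<Otimes>\<^sub>M N')"
    and "distr J (N \<Otimes>\<^sub>M N') (\<lambda>\<omega>. (U \<omega>, V \<omega>)) =
      density (distr J N U \<Otimes>\<^sub>M distr J N' V) (\<lambda>(x, y). k (r x, y))"
proof
  let ?Y = "\<lambda>\<omega>. r (U \<omega>)"
  let ?\<nu> = "distr J N U" and ?\<nu>' = "distr J N' V" and ?\<mu> = "distr J borel ?Y"
  let ?L = "distr J (N \<Otimes>\<^sub>M N') (\<lambda>\<omega>. (U \<omega>, V \<omega>))"
  let ?Q = "distr J (borel \<Otimes>\<^sub>M N') (\<lambda>\<omega>. (?Y \<omega>, V \<omega>))"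
  let ?k = "RN_deriv (?\<mu> \<Otimes>\<^sub>M ?\<nu>') ?Q"
  interpret \<nu>: prob_space ?\<nu> by (rule prob_space_distr) simp
  interpret \<nu>': prob_space ?\<nu>' by (rule prob_space_distr) simp
  interpret \<mu>: prob_space ?\<mu> by (rule prob_space_distr) simp
  interpret Q: prob_space ?Q by (rule prob_space_distr) simp
  interpret L: prob_space ?L by (rule prob_space_distr) simp
  interpret \<mu>\<nu>': pair_prob_space ?\<mu> ?\<nu>' ..
  have sets_\<mu>\<nu>': "sets (?\<mu> \<Otimes>\<^sub>M ?\<nu>') = sets (borel \<Otimes>\<^sub>M N')"
    by (rule sets_pair_measure_cong) auto
  have sets_\<nu>\<nu>': "sets (?\<nu> \<Otimes>\<^sub>M ?\<nu>') = sets (N \<Otimes>\<^sub>M N')"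
    by (rule sets_pair_measure_cong) auto
  show k[measurable]: "?k \<in> borel_measurable (borel \<Otimes>\<^sub>M N')"
    using borel_measurable_RN_deriv[of "?\<mu> \<Otimes>\<^sub>M ?\<nu>'" ?Q] measurable_cong_sets[OF sets_\<mu>\<nu>' refl] by blast
  have \<mu>_eq: "?\<mu> = distr ?\<nu> borel r"
    by (simp add: distr_distr comp_def)
  have rid[measurable]: "(\<lambda>(x, y). (r x, y)) \<in> ?\<nu> \<Otimes>\<^sub>M ?\<nu>' \<rightarrow>\<^sub>M borel \<Otimes>\<^sub>M N'"
    by measurable
  have \<mu>\<nu>'_eq: "?\<mu> \<Otimes>\<^sub>M ?\<nu>' = distr (?\<nu> \<Otimes>\<^sub>M ?\<nu>') (borel \<Otimes>\<^sub>M N') (\<lambda>(x, y). (r x, y))"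
  proof -
    have "distr ?\<nu>' N' (\<lambda>y. y) = ?\<nu>'"
      by (rule distr_id2) simp
    with pair_measure_distr[of r ?\<nu> borel "\<lambda>y. y" ?\<nu>' N'] \<nu>'.sigma_finite_measure_axioms
    show ?thesis by (simp add: \<mu>_eq[symmetric])
  qed
  have Q_eq: "?Q = distr ?L (borel \<Otimes>\<^sub>M N') (\<lambda>(x, y). (r x, y))"
    by (subst distr_distr) (auto simp: comp_def)
  have "absolutely_continuous (?\<mu> \<Otimes>\<^sub>M ?\<nu>') ?Q"
    unfolding absolutely_continuous_def
  proof
    fix B assume B: "B \<in> null_sets (?\<mu> \<Otimes>\<^sub>M ?\<nu>')"
    then have Bm[measurable]: "B \<in> sets (borel \<Otimes>\<^sub>M N')"
      using sets_\<mu>\<nu>' by (auto dest: null_setsD2)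
    let ?B = "(\<lambda>(x, y). (r x, y)) -` B \<inter> space (N \<Otimes>\<^sub>M N')"
    have "?B \<in> sets (N \<Otimes>\<^sub>M N')"
      by (rule measurable_sets[OF _ Bm]) measurable
    moreover have "emeasure (?\<nu> \<Otimes>\<^sub>M ?\<nu>') ?B = 0"
      using B unfolding \<mu>\<nu>'_eq by (auto simp: null_sets_def emeasure_distr space_pair_measure)
    ultimately have "?B \<in> null_sets (?\<nu> \<Otimes>\<^sub>M ?\<nu>')"
      using sets_\<nu>\<nu>' by (intro null_setsI) auto
    then have "?B \<in> null_sets ?L"
      using ac unfolding absolutely_continuous_def by blast
    then show "B \<in> null_sets ?Q"
      unfolding Q_eq by (auto simp: null_sets_def emeasure_distr)
  qed
  then have Q: "?Q = density (?\<mu> \<Otimes>\<^sub>M ?\<nu>') ?k"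
    by (subst \<mu>\<nu>'.density_RN_deriv) (auto simp: sets_\<mu>\<nu>')
  have k'[measurable]: "(\<lambda>(x, y). ?k (r x, y)) \<in> borel_measurable (?\<nu> \<Otimes>\<^sub>M ?\<nu>')"
    by measurable
  show "?L = density (?\<nu> \<Otimes>\<^sub>M ?\<nu>') (\<lambda>(x, y). ?k (r x, y))"
  proof (rule measure_eqI_Times[of _ N N'])
    fix A A' assume A[measurable]: "A \<in> sets N" and A'[measurable]: "A' \<in> sets N'"
    define H where "H z = (\<integral>\<^sup>+y. ?k (z, y) * indicator A' y \<partial>?\<nu>')" for z
    have [measurable]: "H \<in> borel_measurable borel"
      unfolding H_def by measurable
    have Q_Times: "emeasure ?Q (B \<times> A') = (\<integral>\<^sup>+z. indicator B z * H z \<partial>?\<mu>)"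
      if [measurable]: "B \<in> sets borel" for B
    proof -
      have "emeasure ?Q (B \<times> A') = (\<integral>\<^sup>+p. ?k p * indicator (B \<times> A') p \<partial>(?\<mu> \<Otimes>\<^sub>M ?\<nu>'))"
        by (subst Q, rule emeasure_density) (auto simp: sets_\<mu>\<nu>')
      also have "\<dots> = (\<integral>\<^sup>+z. \<integral>\<^sup>+y. ?k (z, y) * indicator (B \<times> A') (z, y) \<partial>?\<nu>' \<partial>?\<mu>)"
        by (rule \<nu>'.nn_integral_fst[symmetric]) measurable
      also have "\<dots> = (\<integral>\<^sup>+z. indicator B z * H z \<partial>?\<mu>)"
        unfolding H_def by (subst nn_integral_cmult[symmetric]) (auto simp: indicator_times ac_simps)
      finally show ?thesis .
    qed
    have "(\<integral>\<^sup>+z. H z \<partial>?\<mu>) \<noteq> \<infinity>"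
      using Q_Times[of UNIV] Q.emeasure_finite[of "UNIV \<times> A'"] by simp
    then have "AE z in ?\<mu>. H z \<noteq> \<infinity>"
      by (intro nn_integral_PInf_AE) auto
    then have fin: "AE x in ?\<nu>. ennreal (enn2real (H (r x))) = H (r x)"
      unfolding \<mu>_eq by (subst (asm) AE_distr_iff) (auto simp: less_top)
    have Hint: "(\<integral>\<^sup>+x. ennreal (indicator B x * enn2real (H (r x))) \<partial>?\<nu>) = (\<integral>\<^sup>+x. indicator B x * H (r x) \<partial>?\<nu>)"
      for B
      using fin by (intro nn_integral_cong_AE) (auto elim!: eventually_mono simp: indicator_def)
    have red_H: "AE x in ?\<nu>. reduced (indicator A') x = enn2real (H (r x))"
    proof (rule reduced_eq_factor)
      show "integrable J (\<lambda>\<omega>. indicator A' (V \<omega>) :: real)"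
        by (rule integrable_const_bound[where B=1]) auto
      show "integrable ?\<nu> (\<lambda>x. enn2real (H (r x)))"
      proof (rule integrableI_nonneg)
        show "(\<integral>\<^sup>+x. ennreal (enn2real (H (r x))) \<partial>?\<nu>) < \<infinity>"
          using Hint[of UNIV] \<open>(\<integral>\<^sup>+z. H z \<partial>?\<mu>) \<noteq> \<infinity>\<close> unfolding \<mu>_eq
          by (simp add: nn_integral_distr less_top)
      qed auto
    next
      fix B :: "'z set" assume B[measurable]: "B \<in> sets borel"
      have "(\<integral>\<omega>. indicat_real B (?Y \<omega>) * indicator A' (V \<omega>) \<partial>J) =
          (\<integral>p. indicat_real (B \<times> A') p \<partial>?Q)"
        by (subst integral_distr) (auto simp: indicator_times)
      also have "\<dots> = measure ?Q (B \<times> A')"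
        by simp
      also have "\<dots> = enn2real (\<integral>\<^sup>+x. indicator B (r x) * H (r x) \<partial>?\<nu>)"
        unfolding measure_def Q_Times[OF B] by (simp add: \<mu>_eq nn_integral_distr)
      also have "\<dots> = enn2real (\<integral>\<^sup>+x. ennreal (indicator (r -` B) x * enn2real (H (r x))) \<partial>?\<nu>)"
        unfolding Hint by (simp add: indicator_def vimage_def)
      also have "\<dots> = (\<integral>x. indicator B (r x) * enn2real (H (r x)) \<partial>?\<nu>)"
        by (subst integral_eq_nn_integral) (auto simp: indicator_def)
      finally show "(\<integral>\<omega>. indicat_real B (?Y \<omega>) * indicator A' (V \<omega>) \<partial>J) =
          (\<integral>x. indicator B (r x) * enn2real (H (r x)) \<partial>?\<nu>)" .
    qed auto
    obtain g where g: "full_version (indicator A') g" "AE x in ?\<nu>. reduced (indicator A') x = g x"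
      using red[OF A'] by blast
    have gH: "AE x in ?\<nu>. g x = enn2real (H (r x))"
      using g(2) red_H by eventually_elim auto
    have [measurable]: "g \<in> borel_measurable N" using g(1) by (auto simp: full_version_def)
    have "emeasure ?L (A \<times> A') = ennreal (\<integral>p. indicat_real (A \<times> A') p \<partial>?L)"
      by (simp add: L.emeasure_eq_measure)
    also have "(\<integral>p. indicat_real (A \<times> A') p \<partial>?L) = (\<integral>\<omega>. indicat_real A (U \<omega>) * indicator A' (V \<omega>) \<partial>J)"
      by (subst integral_distr) (auto simp: indicator_times)
    also have "\<dots> = (\<integral>x. indicat_real A x * g x \<partial>?\<nu>)"
      using g(1) A by (auto simp: full_version_def)
    also have "\<dots> = (\<integral>x. indicator A x * enn2real (H (r x)) \<partial>?\<nu>)"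
      using gH by (intro integral_cong_AE) (auto elim!: eventually_mono)
    also have "ennreal \<dots> = (\<integral>\<^sup>+x. ennreal (indicator A x * enn2real (H (r x))) \<partial>?\<nu>)"
    proof (rule nn_integral_eq_integral[symmetric])
      have "integrable ?\<nu> (\<lambda>x. indicator A x *\<^sub>R g x)"
        using g(1) by (intro integrable_mult_indicator) (auto simp: full_version_def)
      then show "integrable ?\<nu> (\<lambda>x. indicator A x * enn2real (H (r x)))"
        using gH by (subst integrable_cong_AE[where g="\<lambda>x. indicator A x *\<^sub>R g x"])
          (auto elim!: eventually_mono)
    qed auto
    also have "\<dots> = (\<integral>\<^sup>+x. indicator A x * H (r x) \<partial>?\<nu>)"
      by (rule Hint)
    also have "\<dots> = (\<integral>\<^sup>+x. \<integral>\<^sup>+y. ?k (r x, y) * indicator (A \<times> A') (x, y) \<partial>?\<nu>' \<partial>?\<nu>)"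
    proof (rule nn_integral_cong)
      fix x assume x: "x \<in> space ?\<nu>"
      have "(\<lambda>y. ?k (r x, y)) \<in> borel_measurable ?\<nu>'" by measurable
      then show "indicator A x * H (r x) = (\<integral>\<^sup>+y. ?k (r x, y) * indicator (A \<times> A') (x, y) \<partial>?\<nu>')"
        unfolding H_def by (subst nn_integral_cmult[symmetric]) (auto simp: indicator_times ac_simps)
    qed
    also have "\<dots> = (\<integral>\<^sup>+p. (case p of (x, y) \<Rightarrow> ?k (r x, y)) * indicator (A \<times> A') p \<partial>(?\<nu> \<Otimes>\<^sub>M ?\<nu>'))"
      by (subst \<nu>'.nn_integral_fst[symmetric]) auto
    also have "\<dots> = emeasure (density (?\<nu> \<Otimes>\<^sub>M ?\<nu>') (\<lambda>(x, y). ?k (r x, y))) (A \<times> A')"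
      by (rule emeasure_density[symmetric]) (auto simp: sets_\<nu>\<nu>')
    finally show "emeasure ?L (A \<times> A') =
        emeasure (density (?\<nu> \<Otimes>\<^sub>M ?\<nu>') (\<lambda>(x, y). ?k (r x, y))) (A \<times> A')" .
  qed (auto simp: sets_\<nu>\<nu>' L.finite_measure_axioms)
qed

end

section \<open>Conditioning under a joint density\<close>

locale density_conditioning = reduced_conditioning J N N' U V r + N: sigma_finite_measure N +
    N': sigma_finite_measure N'
  for J :: "'w measure" and N :: "'a measure" and N' :: "'b measure"
    and U :: "'w \<Rightarrow> 'a" and V :: "'w \<Rightarrow> 'b" and r :: "'a \<Rightarrow> 'z::topological_space" +
  fixes j :: "'a \<Rightarrow> 'b \<Rightarrow> real"
  assumes j[measurable]: "(\<lambda>(x, y). j x y) \<in> borel_measurable (N \<Otimes>\<^sub>M N')"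
    and j_nonneg: "\<And>x y. x \<in> space N \<Longrightarrow> y \<in> space N' \<Longrightarrow> 0 \<le> j x y"
    and law: "distr J (N \<Otimes>\<^sub>M N') (\<lambda>\<omega>. (U \<omega>, V \<omega>)) =
      density (N \<Otimes>\<^sub>M N') (\<lambda>(x, y). ennreal (j x y))"
begin

sublocale NN': pair_sigma_finite N N' ..

definition marginal :: "'a \<Rightarrow> real" where
  "marginal x = (\<integral>y. j x y \<partial>N')"

definition marginal' :: "'b \<Rightarrow> real" where
  "marginal' y = (\<integral>x. j x y \<partial>N)"

text \<open>Integration against the conditional density of \<open>V\<close> given \<open>U = x\<close>. Where the marginal density
  vanishes, division by zero makes the value zero.\<close>

definition full :: "('b \<Rightarrow> real) \<Rightarrow> 'a \<Rightarrow> real" where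
  "full f x = (\<integral>y. j x y / marginal x * f y \<partial>N')"

lemma marginal_measurable[measurable]: "marginal \<in> borel_measurable N"
  unfolding marginal_def by measurable

lemma marginal'_measurable[measurable]: "marginal' \<in> borel_measurable N'"
  unfolding marginal'_def by measurable

lemma full_measurable:
  assumes [measurable]: "f \<in> borel_measurable N'"
  shows "full f \<in> borel_measurable N"
  unfolding full_def by measurable

lemma marginal_nonneg: "x \<in> space N \<Longrightarrow> 0 \<le> marginal x"
  unfolding marginal_def by (rule integral_nonneg_AE) (auto intro: j_nonneg)

lemma marginal'_nonneg: "y \<in> space N' \<Longrightarrow> 0 \<le> marginal' y"
  unfolding marginal'_def by (rule integral_nonneg_AE) (auto intro: j_nonneg)

lemma j_integrable: "integrable (N \<Otimes>\<^sub>M N') (\<lambda>(x, y). j x y)"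
proof (rule integrableI_nonneg)
  interpret L: prob_space "distr J (N \<Otimes>\<^sub>M N') (\<lambda>\<omega>. (U \<omega>, V \<omega>))"
    by (rule prob_space_distr) simp
  have "(\<integral>\<^sup>+p. ennreal (case p of (x, y) \<Rightarrow> j x y) \<partial>(N \<Otimes>\<^sub>M N')) =
      emeasure (density (N \<Otimes>\<^sub>M N') (\<lambda>(x, y). ennreal (j x y))) (space (N \<Otimes>\<^sub>M N'))"
    by (subst emeasure_density) (auto intro!: nn_integral_cong split: prod.splits)
  also have "\<dots> = 1"
    using L.emeasure_space_1 unfolding law by simp
  finally show "(\<integral>\<^sup>+p. ennreal (case p of (x, y) \<Rightarrow> j x y) \<partial>(N \<Otimes>\<^sub>M N')) < \<infinity>"
    by simp
qed (auto intro!: AE_I2 j_nonneg simp: space_pair_measure)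

lemma AE_j_integrable: "AE x in N. integrable N' (j x)"
  using NN'.AE_integrable_fst'[OF j_integrable] by simp

lemma nn_integral_j:
  assumes "x \<in> space N" "integrable N' (j x)"
  shows "(\<integral>\<^sup>+y. ennreal (j x y) \<partial>N') = ennreal (marginal x)"
  unfolding marginal_def using assms by (intro nn_integral_eq_integral) (auto intro: j_nonneg)

lemma AE_j_integrable': "AE y in N'. integrable N (\<lambda>x. j x y)"
proof -
  interpret N'N: pair_sigma_finite N' N ..
  have "integrable (N' \<Otimes>\<^sub>M N) (\<lambda>(y, x). j x y)"
    using NN'.integrable_product_swap[OF j_integrable] by simp
  from N'N.AE_integrable_fst'[OF this] show ?thesis by simp
qed

lemma law_fst: "distr J N U = density N marginal"
proof (rule measure_eqI)
  fix A assume "A \<in> sets (distr J N U)"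
  then have [measurable]: "A \<in> sets N" by simp
  have "distr J N U = distr (distr J (N \<Otimes>\<^sub>M N') (\<lambda>\<omega>. (U \<omega>, V \<omega>))) N fst"
    by (subst distr_distr) (auto simp: comp_def)
  then have "emeasure (distr J N U) A =
      emeasure (density (N \<Otimes>\<^sub>M N') (\<lambda>(x, y). ennreal (j x y))) (fst -` A \<inter> space (N \<Otimes>\<^sub>M N'))"
    unfolding law by (simp add: emeasure_distr)
  also have "\<dots> = (\<integral>\<^sup>+p. (case p of (x, y) \<Rightarrow> ennreal (j x y)) * indicator A (fst p) \<partial>(N \<Otimes>\<^sub>M N'))"
    by (subst emeasure_density) (auto intro!: nn_integral_cong simp: indicator_def)
  also have "\<dots> = (\<integral>\<^sup>+x. \<integral>\<^sup>+y. ennreal (j x y) * indicator A x \<partial>N' \<partial>N)"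
    by (subst N'.nn_integral_fst[symmetric]) auto
  also have "\<dots> = (\<integral>\<^sup>+x. ennreal (marginal x) * indicator A x \<partial>N)"
  proof (rule nn_integral_cong_AE)
    show "AE x in N. (\<integral>\<^sup>+y. ennreal (j x y) * indicator A x \<partial>N') = ennreal (marginal x) * indicator A x"
      using AE_j_integrable AE_space
    proof eventually_elim
      case (elim x)
      then show ?case
        using nn_integral_j[of x] by (cases "x \<in> A") auto
    qed
  qed
  also have "\<dots> = emeasure (density N marginal) A"
    by (rule emeasure_density[symmetric]) auto
  finally show "emeasure (distr J N U) A = emeasure (density N marginal) A" .
qed simp

lemma law_snd: "distr J N' V = density N' marginal'"
proof (rule measure_eqI)
  fix A assume "A \<in> sets (distr J N' V)"
  then have [measurable]: "A \<in> sets N'" by simp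
  have "distr J N' V = distr (distr J (N \<Otimes>\<^sub>M N') (\<lambda>\<omega>. (U \<omega>, V \<omega>))) N' snd"
    by (subst distr_distr) (auto simp: comp_def)
  then have "emeasure (distr J N' V) A =
      emeasure (density (N \<Otimes>\<^sub>M N') (\<lambda>(x, y). ennreal (j x y))) (snd -` A \<inter> space (N \<Otimes>\<^sub>M N'))"
    unfolding law by (simp add: emeasure_distr)
  also have "\<dots> = (\<integral>\<^sup>+p. (case p of (x, y) \<Rightarrow> ennreal (j x y)) * indicator A (snd p) \<partial>(N \<Otimes>\<^sub>M N'))"
    by (subst emeasure_density) (auto intro!: nn_integral_cong simp: indicator_def)
  also have "\<dots> = (\<integral>\<^sup>+y. \<integral>\<^sup>+x. ennreal (j x y) * indicator A y \<partial>N \<partial>N')"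
    by (subst NN'.nn_integral_snd[symmetric]) auto
  also have "\<dots> = (\<integral>\<^sup>+y. ennreal (marginal' y) * indicator A y \<partial>N')"
  proof (rule nn_integral_cong_AE)
    show "AE y in N'. (\<integral>\<^sup>+x. ennreal (j x y) * indicator A y \<partial>N) = ennreal (marginal' y) * indicator A y"
      using AE_j_integrable' AE_space
    proof eventually_elim
      case (elim y)
      then have "(\<integral>\<^sup>+x. ennreal (j x y) \<partial>N) = ennreal (marginal' y)"
        unfolding marginal'_def by (intro nn_integral_eq_integral) (auto intro: j_nonneg)
      then show ?case by (cases "y \<in> A") auto
    qed
  qed
  also have "\<dots> = emeasure (density N' marginal') A"
    by (rule emeasure_density[symmetric]) auto
  finally show "emeasure (distr J N' V) A = emeasure (density N' marginal') A" .
qed simp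

lemma AE_j_eq_0:
  "AE x in N. marginal x = 0 \<longrightarrow> (AE y in N'. j x y = 0)"
  using AE_j_integrable AE_space
proof eventually_elim
  case (elim x)
  show ?case
  proof
    assume "marginal x = 0"
    moreover have "AE y in N'. 0 \<le> j x y" using elim by (auto intro: j_nonneg)
    ultimately show "AE y in N'. j x y = 0"
      using integral_nonneg_eq_0_iff_AE[of N' "j x"] elim unfolding marginal_def by simp
  qed
qed

text \<open>Where the marginal density vanishes, so does \<open>j x y\<close> for almost every \<open>y\<close>, so that clearing the
  denominator is correct there as well.\<close>

lemma marginal_mult_full:
  assumes [measurable]: "f \<in> borel_measurable N'"
  shows "AE x in N. marginal x * full f x = (\<integral>y. j x y * f y \<partial>N')"
  using AE_j_eq_0 AE_space
proof eventually_elim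
  case (elim x)
  show ?case
  proof (cases "marginal x = 0")
    case True
    with elim have "AE y in N'. j x y = 0" by simp
    then have "AE y in N'. j x y * f y = 0" by eventually_elim simp
    then have "(\<integral>y. j x y * f y \<partial>N') = 0"
      by (rule integral_eq_zero_AE)
    with True show ?thesis by simp
  next
    case False
    have "marginal x * full f x = (\<integral>y. marginal x * (j x y / marginal x * f y) \<partial>N')"
      unfolding full_def by (rule integral_mult_right_zero[symmetric])
    with False show ?thesis by simp
  qed
qed

lemma full_version_full:
  assumes f[measurable]: "f \<in> borel_measurable N'" and fi: "integrable J (\<lambda>\<omega>. f (V \<omega>))"
  shows "full_version f (full f)"
proof -
  note [measurable] = full_measurable[OF f]
  let ?L = "distr J (N \<Otimes>\<^sub>M N') (\<lambda>\<omega>. (U \<omega>, V \<omega>))"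
  have nn: "AE p in N \<Otimes>\<^sub>M N'. 0 \<le> (case p of (x, y) \<Rightarrow> j x y)"
    by (auto intro!: AE_I2 j_nonneg simp: space_pair_measure)
  have L: "?L = density (N \<Otimes>\<^sub>M N') (\<lambda>p. ennreal (case p of (x, y) \<Rightarrow> j x y))"
    unfolding law by (rule arg_cong[where f="density _"]) (auto split: prod.splits)
  have "integrable ?L (\<lambda>p. f (snd p))"
    using fi by (subst integrable_distr_eq) auto
  then have jf: "integrable (N \<Otimes>\<^sub>M N') (\<lambda>(x, y). j x y * f y)"
    unfolding L by (subst (asm) integrable_density[OF _ _ nn]) (simp_all add: case_prod_beta')
  have nnm: "AE x in N. 0 \<le> marginal x" by (auto intro: marginal_nonneg)
  have "integrable N (\<lambda>x. \<integral>y. j x y * f y \<partial>N')"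
    using NN'.integrable_fst'[OF jf] by simp
  then have "integrable N (\<lambda>x. marginal x *\<^sub>R full f x)"
    by (subst integrable_cong_AE[where g="\<lambda>x. \<integral>y. j x y * f y \<partial>N'"])
      (use marginal_mult_full[OF f] in auto)
  then have int: "integrable (distr J N U) (full f)"
    unfolding law_fst by (subst integrable_density[OF _ _ nnm]) auto
  moreover have "(\<integral>\<omega>. indicator A (U \<omega>) * f (V \<omega>) \<partial>J) = (\<integral>x. indicator A x * full f x \<partial>distr J N U)"
    if A[measurable]: "A \<in> sets N" for A
  proof -
    have "(\<integral>\<omega>. indicator A (U \<omega>) * f (V \<omega>) \<partial>J) = (\<integral>p. indicat_real A (fst p) * f (snd p) \<partial>?L)"
      by (subst integral_distr) auto
    also have "\<dots> = (\<integral>p. (case p of (x, y) \<Rightarrow> j x y) * (indicat_real A (fst p) * f (snd p)) \<partial>(N \<Otimes>\<^sub>M N'))"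
      unfolding L by (subst integral_density[OF _ _ nn]) auto
    also have "\<dots> = (\<integral>x. \<integral>y. j x y * (indicat_real A x * f y) \<partial>N' \<partial>N)"
    proof (subst NN'.integral_fst'[symmetric])
      show "integrable (N \<Otimes>\<^sub>M N') (\<lambda>p. (case p of (x, y) \<Rightarrow> j x y) * (indicat_real A (fst p) * f (snd p)))"
        by (rule Bochner_Integration.integrable_bound[OF jf])
          (auto simp: indicator_def split: prod.splits)
    qed simp
    also have "\<dots> = (\<integral>x. marginal x *\<^sub>R (indicator A x * full f x) \<partial>N)"
    proof (rule integral_cong_AE)
      show "AE x in N. (\<integral>y. j x y * (indicat_real A x * f y) \<partial>N') = marginal x *\<^sub>R (indicator A x * full f x)"
        using marginal_mult_full[OF f] by eventually_elim (auto simp: indicator_def)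
    qed auto
    also have "\<dots> = (\<integral>x. indicator A x * full f x \<partial>distr J N U)"
      unfolding law_fst by (subst integral_density[OF _ _ nnm]) auto
    finally show ?thesis .
  qed
  ultimately show ?thesis by (auto simp: full_version_def)
qed

lemma reduced_eq_full:
  assumes f: "f \<in> borel_measurable N'" and fi: "integrable J (\<lambda>\<omega>. f (V \<omega>))"
    and G: "G \<in> borel_measurable borel" "AE x in density N marginal. full f x = G (r x)"
  shows "AE x in density N marginal. reduced f x = full f x"
  by (rule reduced_eq_full_version[OF fi full_version_full[OF f fi] G(1), unfolded law_fst, OF G(2)])

text \<open>Since \<open>j\<close> vanishes almost everywhere outside the set where both marginal densities are positive,
  the law of \<open>(U, V)\<close> is absolutely continuous with respect to the product of its marginals.
  The factorization of the law is then one of densities, by uniqueness of densities.\<close>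

lemma density_factorizes:
  assumes "\<And>A. A \<in> sets N' \<Longrightarrow>
      AE x in density N marginal. reduced (indicator A) x = full (indicator A) x"
  obtains k :: "'z \<Rightarrow> 'b \<Rightarrow> real"
  where "(\<lambda>(z, y). k z y) \<in> borel_measurable (borel \<Otimes>\<^sub>M N')" "\<And>z y. 0 \<le> k z y"
    "AE p in N \<Otimes>\<^sub>M N'. j (fst p) (snd p) = marginal (fst p) * (k (r (fst p)) (snd p) * marginal' (snd p))"
proof -
  let ?L = "distr J (N \<Otimes>\<^sub>M N') (\<lambda>\<omega>. (U \<omega>, V \<omega>))"
  have "prob_space (distr J N' V)" by (rule prob_space_distr) simp
  then have sf: "sigma_finite_measure (density N' marginal')"
    unfolding law_snd by (rule prob_space_imp_sigma_finite)
  have prod: "distr J N U \<Otimes>\<^sub>M distr J N' V =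
      density (N \<Otimes>\<^sub>M N') (\<lambda>(x, y). ennreal (marginal x) * ennreal (marginal' y))"
    unfolding law_fst law_snd
    by (rule pair_measure_density) (auto intro: sf N'.sigma_finite_measure_axioms)
  interpret N'N: pair_sigma_finite N' N ..
  \<comment> \<open>The density vanishes wherever the first marginal does; below, the same for the second.\<close>
  have j0: "AE p in N \<Otimes>\<^sub>M N'. marginal (fst p) = 0 \<longrightarrow> j (fst p) (snd p) = 0"
    by (rule NN'.AE_pair_measure) (use AE_j_eq_0 in \<open>auto elim!: eventually_mono\<close>)
  have "AE y in N'. marginal' y = 0 \<longrightarrow> (AE x in N. j x y = 0)"
    using AE_j_integrable' AE_space
  proof eventually_elim
    case (elim y)
    show ?case
    proof
      assume "marginal' y = 0"
      moreover have "AE x in N. 0 \<le> j x y" using elim by (auto intro: j_nonneg)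
      ultimately show "AE x in N. j x y = 0"
        using integral_nonneg_eq_0_iff_AE[of N "\<lambda>x. j x y"] elim unfolding marginal'_def by simp
    qed
  qed
  then have "AE y in N'. AE x in N. marginal' y = 0 \<longrightarrow> j x y = 0"
    by (auto elim!: eventually_mono)
  then have "AE x in N. AE y in N'. marginal' y = 0 \<longrightarrow> j x y = 0"
    by (subst NN'.AE_commute) auto
  then have j0': "AE p in N \<Otimes>\<^sub>M N'. marginal' (snd p) = 0 \<longrightarrow> j (fst p) (snd p) = 0"
    by (intro NN'.AE_pair_measure) auto
  have ac: "absolutely_continuous (distr J N U \<Otimes>\<^sub>M distr J N' V) ?L"
    unfolding absolutely_continuous_def
  proof
    fix B assume "B \<in> null_sets (distr J N U \<Otimes>\<^sub>M distr J N' V)"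
    then have B: "B \<in> sets (N \<Otimes>\<^sub>M N')"
      "AE p in N \<Otimes>\<^sub>M N'. p \<in> B \<longrightarrow> ennreal (marginal (fst p)) * ennreal (marginal' (snd p)) = 0"
      unfolding prod by (auto simp: null_sets_density_iff case_prod_beta)
    have "AE p in N \<Otimes>\<^sub>M N'. p \<in> B \<longrightarrow> ennreal (j (fst p) (snd p)) = 0"
      using B(2) j0 j0' AE_space
    proof eventually_elim
      case (elim p)
      then show ?case
        using marginal_nonneg[of "fst p"] marginal'_nonneg[of "snd p"]
        by (auto simp: space_pair_measure ennreal_eq_0_iff)
    qed
    with B(1) show "B \<in> null_sets ?L"
      unfolding law by (simp add: null_sets_density_iff case_prod_beta)
  qed
  have "\<exists>g. full_version (indicator A) g \<and> (AE x in distr J N U. reduced (indicator A) x = g x)"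
    if A[measurable]: "A \<in> sets N'" for A
  proof (intro exI conjI)
    show "full_version (indicator A) (full (indicator A))"
      by (rule full_version_full) (auto intro!: integrable_const_bound[where B=1])
    show "AE x in distr J N U. reduced (indicator A) x = full (indicator A) x"
      unfolding law_fst by (rule assms[OF A])
  qed
  then obtain k where k[measurable]: "k \<in> borel_measurable (borel \<Otimes>\<^sub>M N')"
    and Lk: "?L = density (distr J N U \<Otimes>\<^sub>M distr J N' V) (\<lambda>(x, y). k (r x, y))"
    by (rule law_factorizes[OF ac])
  have "density (N \<Otimes>\<^sub>M N') (\<lambda>(x, y). ennreal (j x y)) =
      density (N \<Otimes>\<^sub>M N') (\<lambda>p. (case p of (x, y) \<Rightarrow> ennreal (marginal x) * ennreal (marginal' y)) *
        (case p of (x, y) \<Rightarrow> k (r x, y)))"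
    using Lk unfolding prod law by (subst (asm) density_density_eq) auto
  then have "AE p in N \<Otimes>\<^sub>M N'. (case p of (x, y) \<Rightarrow> ennreal (j x y)) =
      (case p of (x, y) \<Rightarrow> ennreal (marginal x) * ennreal (marginal' y)) *
        (case p of (x, y) \<Rightarrow> k (r x, y))"
    by (subst (asm) NN'.density_unique_iff) auto
  then have "AE p in N \<Otimes>\<^sub>M N'. j (fst p) (snd p) =
      marginal (fst p) * (enn2real (k (r (fst p), snd p)) * marginal' (snd p))"
    using AE_space
  proof eventually_elim
    case (elim p)
    have nn: "0 \<le> j (fst p) (snd p)" "0 \<le> marginal (fst p)" "0 \<le> marginal' (snd p)"
      using elim(2) by (auto simp: space_pair_measure intro: j_nonneg marginal_nonneg marginal'_nonneg)
    have "enn2real (ennreal (j (fst p) (snd p))) =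
        enn2real (ennreal (marginal (fst p)) * ennreal (marginal' (snd p)) * k (r (fst p), snd p))"
      using elim(1) by (simp add: case_prod_beta)
    with nn show ?case by (simp add: enn2real_mult)
  qed
  then show ?thesis
    by (intro that[of "\<lambda>z y. enn2real (k (z, y))"]) auto
qed

end

lemma prob_densityD:
  assumes "prob_density S w" "S \<in> sets lebesgue"
  shows "w \<in> borel_measurable (lebesgue_on S)" "\<And>x. x \<in> S \<Longrightarrow> 0 \<le> w x"
    "integrable (lebesgue_on S) w" "integral\<^sup>L (lebesgue_on S) w = 1"
proof -
  show m: "w \<in> borel_measurable (lebesgue_on S)" and nn: "\<And>x. x \<in> S \<Longrightarrow> 0 \<le> w x"
    using assms by (auto simp: prob_density_def)
  have 1: "(\<integral>\<^sup>+x. ennreal (w x) \<partial>lebesgue_on S) = ennreal 1"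
    using assms by (auto simp: prob_density_def)
  show "integrable (lebesgue_on S) w"
    by (rule integrableI_nonneg) (use m nn 1 in \<open>auto intro!: AE_I2\<close>)
  show "integral\<^sup>L (lebesgue_on S) w = 1"
    by (subst integral_eq_nn_integral) (use m nn 1 in \<open>auto intro!: AE_I2\<close>)
qed

lemma section_measurable:
  assumes f: "(\<lambda>(x, y). f x y) \<in> borel_measurable (N \<Otimes>\<^sub>M N')"
  shows "x \<in> space N \<Longrightarrow> f x \<in> borel_measurable N'"
    and "y \<in> space N' \<Longrightarrow> (\<lambda>x. f x y) \<in> borel_measurable N"
  using measurable_compose[OF measurable_Pair1' f, of x] measurable_compose[OF measurable_Pair2' f, of y]
  by simp_all

section \<open>Conditioning for a transition density\<close>

locale transition =
  fixes S :: "'a::euclidean_space set" and r :: "'a \<Rightarrow> 'z::t2_space"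
    and \<rho>0 :: "'a \<Rightarrow> real" and p :: "'a \<Rightarrow> 'a \<Rightarrow> real"
  assumes S: "S \<in> sets lebesgue" and r: "continuous_on S r"
    and \<rho>0: "prob_density S \<rho>0" and p: "density_kernel S p"
begin

abbreviation "\<Lambda> \<equiv> lebesgue_on S"
abbreviation "\<rho>\<^sub>1 \<equiv> \<rho>1 S \<rho>0 p"
abbreviation "J \<equiv> joint_law S \<rho>0 p"

sublocale \<Lambda>: sigma_finite_measure \<Lambda>
  by (rule sigma_finite_lebesgue_on[OF S])

sublocale \<Lambda>\<Lambda>: pair_sigma_finite \<Lambda> \<Lambda> ..

lemma r_measurable[measurable]: "r \<in> borel_measurable \<Lambda>"
  using r S by (rule continuous_imp_measurable_on_sets_lebesgue)

lemma p_measurable[measurable]: "(\<lambda>(x, y). p x y) \<in> borel_measurable (\<Lambda> \<Otimes>\<^sub>M \<Lambda>)"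
  using p by (simp add: density_kernel_def)

lemma p_density: "x \<in> S \<Longrightarrow> prob_density S (p x)"
  using p by (simp add: density_kernel_def)

lemmas p_nonneg = prob_densityD(2)[OF p_density S]
lemmas \<rho>0_measurable[measurable] = prob_densityD(1)[OF \<rho>0 S]
lemmas \<rho>0_nonneg = prob_densityD(2)[OF \<rho>0 S]

lemma space_J: "space J = S \<times> S"
  by (simp add: joint_law_def space_pair_measure)

lemma sets_J[measurable_cong]: "sets J = sets (\<Lambda> \<Otimes>\<^sub>M \<Lambda>)"
  by (simp add: joint_law_def)

lemma prob_space_J: "prob_space J"
proof
  have "emeasure J (space J) = (\<integral>\<^sup>+q. (case q of (x, y) \<Rightarrow> ennreal (\<rho>0 x * p x y)) \<partial>(\<Lambda> \<Otimes>\<^sub>M \<Lambda>))"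
    unfolding joint_law_def by (subst emeasure_density) (auto intro!: nn_integral_cong)
  also have "\<dots> = (\<integral>\<^sup>+x. \<integral>\<^sup>+y. ennreal (\<rho>0 x * p x y) \<partial>\<Lambda> \<partial>\<Lambda>)"
    by (subst \<Lambda>.nn_integral_fst[symmetric]) auto
  also have "\<dots> = (\<integral>\<^sup>+x. ennreal (\<rho>0 x) \<partial>\<Lambda>)"
  proof (rule nn_integral_cong)
    fix x assume "x \<in> space \<Lambda>"
    then have x: "x \<in> S" by simp
    have [measurable]: "p x \<in> borel_measurable \<Lambda>" by (rule prob_densityD(1)[OF p_density[OF x] S])
    have "(\<integral>\<^sup>+y. ennreal (\<rho>0 x * p x y) \<partial>\<Lambda>) = (\<integral>\<^sup>+y. ennreal (\<rho>0 x) * ennreal (p x y) \<partial>\<Lambda>)"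
      using x by (intro nn_integral_cong) (auto simp: ennreal_mult \<rho>0_nonneg p_nonneg)
    also have "\<dots> = ennreal (\<rho>0 x) * (\<integral>\<^sup>+y. ennreal (p x y) \<partial>\<Lambda>)"
      by (rule nn_integral_cmult) simp
    finally show "(\<integral>\<^sup>+y. ennreal (\<rho>0 x * p x y) \<partial>\<Lambda>) = ennreal (\<rho>0 x)"
      using p_density[OF x] by (simp add: prob_density_def)
  qed
  also have "\<dots> = 1" using \<rho>0 by (simp add: prob_density_def)
  finally show "emeasure J (space J) = 1" .
qed

text \<open>Conditioning on the initial state gives the Koopman operator, conditioning on the final state the
  Perron-Frobenius operator. The second instance uses the joint density with its arguments exchanged.\<close>

sublocale K: density_conditioning J \<Lambda> \<Lambda> fst snd r "\<lambda>x y. \<rho>0 x * p x y"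
proof -
  interpret J: prob_space J by (rule prob_space_J)
  show "density_conditioning J \<Lambda> \<Lambda> fst snd r (\<lambda>x y. \<rho>0 x * p x y)"
  proof
    show "distr J (\<Lambda> \<Otimes>\<^sub>M \<Lambda>) (\<lambda>\<omega>. (fst \<omega>, snd \<omega>)) = density (\<Lambda> \<Otimes>\<^sub>M \<Lambda>) (\<lambda>(x, y). ennreal (\<rho>0 x * p x y))"
      by (simp add: distr_id2 sets_J) (simp add: joint_law_def)
  qed (auto simp: space_J \<rho>0_nonneg p_nonneg)
qed

sublocale T: density_conditioning J \<Lambda> \<Lambda> snd fst r "\<lambda>y x. \<rho>0 x * p x y"
proof -
  interpret J: prob_space J by (rule prob_space_J)
  show "density_conditioning J \<Lambda> \<Lambda> snd fst r (\<lambda>y x. \<rho>0 x * p x y)"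
  proof
    have swap: "(\<lambda>(x, y). (y, x)) \<in> \<Lambda> \<Otimes>\<^sub>M \<Lambda> \<rightarrow>\<^sub>M \<Lambda> \<Otimes>\<^sub>M \<Lambda>" by measurable
    have "density (\<Lambda> \<Otimes>\<^sub>M \<Lambda>) (\<lambda>(y, x). ennreal (\<rho>0 x * p x y)) =
        density (distr (\<Lambda> \<Otimes>\<^sub>M \<Lambda>) (\<Lambda> \<Otimes>\<^sub>M \<Lambda>) (\<lambda>(x, y). (y, x))) (\<lambda>(y, x). ennreal (\<rho>0 x * p x y))"
      using \<Lambda>\<Lambda>.distr_pair_swap by simp
    also have "\<dots> = distr J (\<Lambda> \<Otimes>\<^sub>M \<Lambda>) (\<lambda>\<omega>. (snd \<omega>, fst \<omega>))"
      unfolding joint_law_def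
      by (subst density_distr) (auto simp: case_prod_beta')
    finally show "distr J (\<Lambda> \<Otimes>\<^sub>M \<Lambda>) (\<lambda>\<omega>. (snd \<omega>, fst \<omega>)) =
        density (\<Lambda> \<Otimes>\<^sub>M \<Lambda>) (\<lambda>(y, x). ennreal (\<rho>0 x * p x y))" by simp
  qed (auto simp: space_J \<rho>0_nonneg p_nonneg)
qed

lemma K_marginal: "x \<in> S \<Longrightarrow> K.marginal x = \<rho>0 x"
  using prob_densityD(4)[OF p_density S] by (simp add: K.marginal_def)

lemma K_marginal': "K.marginal' = \<rho>\<^sub>1"
  by (simp add: K.marginal'_def fun_eq_iff \<rho>1_def)

lemma T_marginal: "T.marginal = \<rho>\<^sub>1"
  by (simp add: T.marginal_def fun_eq_iff \<rho>1_def)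

lemma T_marginal': "x \<in> S \<Longrightarrow> T.marginal' x = \<rho>0 x"
  using prob_densityD(4)[OF p_density S] by (simp add: T.marginal'_def)

lemma K_density: "density \<Lambda> K.marginal = density \<Lambda> \<rho>0"
  by (rule density_cong) (auto simp: K_marginal)

lemma koopman_L_eq: "koopman_L S \<rho>0 p r h = K.reduced h"
  by (simp add: koopman_L_def K.reduced_def fun_eq_iff case_prod_beta')

lemma perron_frobenius_D_eq: "perron_frobenius_D S \<rho>0 p r h = T.reduced h"
  by (simp add: perron_frobenius_D_def T.reduced_def fun_eq_iff case_prod_beta')

text \<open>Outside \<open>{x. 0 < \<rho>0 x}\<close> the two sides may differ, because \<open>K.full\<close> is zero there.\<close>

lemma koopman_eq: "x \<in> S \<Longrightarrow> 0 < \<rho>0 x \<Longrightarrow> koopman S p h x = K.full h x"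
  by (simp add: koopman_def K.full_def K_marginal)

lemma perron_frobenius_eq: "perron_frobenius S \<rho>0 p u = T.full u"
  by (simp add: perron_frobenius_def T.full_def T_marginal fun_eq_iff)

lemma AE_density_iff:
  assumes "w \<in> borel_measurable \<Lambda>"
  shows "(AE x in density \<Lambda> (\<lambda>x. ennreal (w x)). P x) \<longleftrightarrow> (AE x in \<Lambda>. 0 < w x \<longrightarrow> P x)"
  using assms by (subst AE_density) auto

lemma koopman_equal_iff:
  "operators_equal S \<rho>0 \<F> (koopman_L S \<rho>0 p r) (koopman S p) \<longleftrightarrow>
   (\<forall>f\<in>\<F>. AE x in density \<Lambda> K.marginal. K.reduced f x = K.full f x)"
proof -
  have "(AE x in \<Lambda>. 0 < \<rho>0 x \<longrightarrow> koopman_L S \<rho>0 p r f x = koopman S p f x) \<longleftrightarrow>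
      (AE x in \<Lambda>. 0 < \<rho>0 x \<longrightarrow> K.reduced f x = K.full f x)" for f
    by (rule AE_cong) (auto simp: koopman_L_eq koopman_eq)
  then show ?thesis
    unfolding operators_equal_def K_density by (simp add: AE_density_iff)
qed

lemma perron_frobenius_equal_iff:
  "operators_equal S \<rho>\<^sub>1 \<F> (perron_frobenius_D S \<rho>0 p r) (perron_frobenius S \<rho>0 p) \<longleftrightarrow>
   (\<forall>f\<in>\<F>. AE x in density \<Lambda> T.marginal. T.reduced f x = T.full f x)"
  unfolding operators_equal_def T_marginal perron_frobenius_D_eq perron_frobenius_eq ..

lemma indicator_in_L_infinity: "A \<in> sets \<Lambda> \<Longrightarrow> indicator A \<in> L_infinity S"
  by (auto simp: L_infinity_def indicator_def intro!: exI[of _ 1])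

lemma indicator_in_L1_weighted: "A \<in> sets \<Lambda> \<Longrightarrow> indicator A \<in> L1_weighted S \<rho>0"
proof -
  assume A: "A \<in> sets \<Lambda>"
  have "prob_space (density \<Lambda> (\<lambda>x. ennreal (\<rho>0 x)))"
    unfolding K_density[symmetric] K.law_fst[symmetric] by (rule K.prob_space_distr) simp
  then interpret prob_space "density \<Lambda> (\<lambda>x. ennreal (\<rho>0 x))" .
  show ?thesis
    unfolding L1_weighted_def using A by (auto intro!: integrable_const_bound[where B=1])
qed

lemma integrable_L_infinity:
  assumes "f \<in> L_infinity S"
  shows "f \<in> borel_measurable \<Lambda>" "integrable J (\<lambda>\<omega>. f (snd \<omega>))"
proof -
  show [measurable]: "f \<in> borel_measurable \<Lambda>" using assms by (simp add: L_infinity_def)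
  obtain C where C: "AE x in \<Lambda>. \<bar>f x\<bar> \<le> C" using assms by (auto simp: L_infinity_def)
  have "AE x in density \<Lambda> K.marginal'. \<bar>f x\<bar> \<le> C"
    using C by (subst AE_density) auto
  then have "AE x in distr J \<Lambda> snd. \<bar>f x\<bar> \<le> C"
    unfolding K.law_snd .
  then have "AE \<omega> in J. \<bar>f (snd \<omega>)\<bar> \<le> C"
    by (rule AE_distrD[rotated]) simp
  then show "integrable J (\<lambda>\<omega>. f (snd \<omega>))"
    by (intro K.integrable_const_bound[where B=C]) auto
qed

lemma integrable_L1_weighted:
  assumes "u \<in> L1_weighted S \<rho>0"
  shows "u \<in> borel_measurable \<Lambda>" "integrable J (\<lambda>\<omega>. u (fst \<omega>))"
proof -
  have u: "integrable (density \<Lambda> (\<lambda>x. ennreal (\<rho>0 x))) u" using assms by (simp add: L1_weighted_def)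
  then show [measurable]: "u \<in> borel_measurable \<Lambda>" by auto
  have "integrable (distr J \<Lambda> fst) u"
    using u by (simp add: K.law_fst K_density)
  then show "integrable J (\<lambda>\<omega>. u (fst \<omega>))"
    by (subst (asm) integrable_distr_eq) auto
qed

lemma \<rho>1_density: "prob_density S \<rho>\<^sub>1"
proof -
  have "prob_space (density \<Lambda> (\<lambda>x. ennreal (\<rho>\<^sub>1 x)))"
    unfolding T_marginal[symmetric] T.law_fst[symmetric] by (rule K.prob_space_distr) simp
  then have "emeasure (density \<Lambda> (\<lambda>x. ennreal (\<rho>\<^sub>1 x))) (space (density \<Lambda> (\<lambda>x. ennreal (\<rho>\<^sub>1 x)))) = 1"
    by (rule prob_space.emeasure_space_1)
  moreover have [measurable]: "\<rho>\<^sub>1 \<in> borel_measurable \<Lambda>"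
    using T.marginal_measurable unfolding T_marginal .
  moreover have "(\<integral>\<^sup>+x. ennreal (\<rho>\<^sub>1 x) \<partial>\<Lambda>) =
      (\<integral>\<^sup>+x. ennreal (\<rho>\<^sub>1 x) * indicator (space \<Lambda>) x \<partial>\<Lambda>)"
    by (rule nn_integral_cong) simp
  ultimately have "(\<integral>\<^sup>+x. ennreal (\<rho>\<^sub>1 x) \<partial>\<Lambda>) = 1"
    by (simp add: emeasure_density)
  then show ?thesis
    using T.marginal_nonneg by (auto simp: prob_density_def T_marginal)
qed

lemma density_version_iff:
  "density_version S \<rho>0 p q \<longleftrightarrow> density_kernel S q \<and>
    (AE x in \<Lambda>. AE y in \<Lambda>. \<rho>0 x * q x y = \<rho>0 x * p x y)"
proof -
  have "(AE x in \<Lambda>. 0 < \<rho>0 x \<longrightarrow> (AE y in \<Lambda>. q x y = p x y)) \<longleftrightarrow>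
      (AE x in \<Lambda>. AE y in \<Lambda>. \<rho>0 x * q x y = \<rho>0 x * p x y)"
    by (rule AE_cong) (use \<rho>0_nonneg in \<open>force simp: less_le\<close>)
  then show ?thesis by (simp add: density_version_def AE_density_iff)
qed

text \<open>A function that agrees with \<open>p\<close> almost everywhere for the joint law need not be a transition
  density for every starting point. Replacing it by the probability density \<open>\<rho>\<^sub>1\<close> where its total mass is
  not one repairs this. Since \<open>\<rho>\<^sub>1\<close> does not depend on \<open>x\<close>, and the condition depends on \<open>x\<close>
  only through \<open>m x\<close>, the replacement preserves the product forms that are needed for
  lumpability and decomposability.\<close>

lemma normalized_density_version:
  fixes m :: "'a \<Rightarrow> 'a \<Rightarrow> real"
  assumes m[measurable]: "(\<lambda>(x, y). m x y) \<in> borel_measurable (\<Lambda> \<Otimes>\<^sub>M \<Lambda>)"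
    and nn: "\<And>x y. x \<in> S \<Longrightarrow> y \<in> S \<Longrightarrow> 0 \<le> m x y"
    and eq: "AE x in \<Lambda>. AE y in \<Lambda>. \<rho>0 x * p x y = \<rho>0 x * m x y"
  shows "density_version S \<rho>0 p
    (\<lambda>x y. if (\<integral>\<^sup>+y. ennreal (m x y) \<partial>\<Lambda>) = 1 then m x y else \<rho>\<^sub>1 y)"
    (is "density_version _ _ _ ?q")
  unfolding density_version_iff density_kernel_def
proof (intro conjI ballI)
  have [measurable]: "\<rho>\<^sub>1 \<in> borel_measurable \<Lambda>"
    using \<rho>1_density by (simp add: prob_density_def)
  show "(\<lambda>(x, y). ?q x y) \<in> borel_measurable (\<Lambda> \<Otimes>\<^sub>M \<Lambda>)"
    by measurable
  show "prob_density S (?q x)" if x: "x \<in> S" for x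
  proof (cases "(\<integral>\<^sup>+y. ennreal (m x y) \<partial>\<Lambda>) = 1")
    case True
    have "m x \<in> borel_measurable \<Lambda>" using section_measurable[OF m] x by simp
    with True x nn show ?thesis by (simp add: prob_density_def)
  next
    case False
    then show ?thesis using \<rho>1_density by simp
  qed
  show "AE x in \<Lambda>. AE y in \<Lambda>. \<rho>0 x * ?q x y = \<rho>0 x * p x y"
    using eq AE_space
  proof eventually_elim
    case (elim x)
    show ?case
    proof (cases "\<rho>0 x = 0")
      case False
      with elim have "AE y in \<Lambda>. p x y = m x y" by simp
      then have "(\<integral>\<^sup>+y. ennreal (m x y) \<partial>\<Lambda>) = (\<integral>\<^sup>+y. ennreal (p x y) \<partial>\<Lambda>)"
        by (intro nn_integral_cong_AE) auto
      also have "\<dots> = 1" using p_density elim by (simp add: prob_density_def)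
      finally have m1: "(\<integral>\<^sup>+y. ennreal (m x y) \<partial>\<Lambda>) = 1" .
      show ?thesis
        using \<open>AE y in \<Lambda>. p x y = m x y\<close> by eventually_elim (simp add: m1)
    qed simp
  qed
qed

section \<open>Lumpable and decomposable transition densities\<close>

text \<open>A version \<open>q\<close> of the transition density gives the same conditional expectation almost everywhere, and
  \<open>q x = pL (r x)\<close> depends on \<open>x\<close> only through \<open>r x\<close>. The factor \<open>G\<close> inherits no measurability from \<open>pL\<close>.\<close>

lemma lumpable_imp_full_factors:
  assumes q: "density_version S \<rho>0 p q" and l: "lumpable S r q"
    and f[measurable]: "f \<in> borel_measurable \<Lambda>"
  shows "\<exists>G. AE x in density \<Lambda> K.marginal. K.full f x = G (r x)"
proof -
  obtain pL where pL: "\<And>x y. x \<in> S \<Longrightarrow> y \<in> S \<Longrightarrow> q x y = pL (r x) y"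
    using l by (auto simp: lumpable_def)
  have "AE x in \<Lambda>. AE y in \<Lambda>. \<rho>0 x * q x y = \<rho>0 x * p x y"
    using q by (simp add: density_version_iff)
  then have "AE x in \<Lambda>. 0 < \<rho>0 x \<longrightarrow> K.full f x = (\<integral>y. pL (r x) y * f y \<partial>\<Lambda>)"
    using AE_space
  proof eventually_elim
    case (elim x)
    then have x: "x \<in> S" by simp
    have [measurable]: "p x \<in> borel_measurable \<Lambda>" "q x \<in> borel_measurable \<Lambda>"
      using p_density q x by (auto simp: density_version_def density_kernel_def prob_density_def)
    show ?case
    proof
      assume pos: "0 < \<rho>0 x"
      have "K.full f x = (\<integral>y. p x y * f y \<partial>\<Lambda>)"
        using x pos by (simp add: K.full_def K_marginal)
      also have "\<dots> = (\<integral>y. q x y * f y \<partial>\<Lambda>)"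
        using elim(1) pos by (intro integral_cong_AE) (auto elim!: eventually_mono)
      also have "\<dots> = (\<integral>y. pL (r x) y * f y \<partial>\<Lambda>)"
        using x by (intro Bochner_Integration.integral_cong) (auto simp: pL)
      finally show "K.full f x = (\<integral>y. pL (r x) y * f y \<partial>\<Lambda>)" .
    qed
  qed
  then show ?thesis
    unfolding K_density by (intro exI[of _ "\<lambda>z. \<integral>y. pL z y * f y \<partial>\<Lambda>"]) (simp add: AE_density_iff)
qed

text \<open>The local factor \<open>plocal (r y) y\<close> does not depend on the initial state \<open>x\<close>, so it cancels between the
  integral against \<open>\<rho>0 x * p x y\<close> and its normalization \<open>\<rho>\<^sub>1 y\<close>. What remains depends on \<open>y\<close> only
  through \<open>r y\<close>.\<close>

lemma decomposable_imp_full_factors: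
  assumes q: "density_version S \<rho>0 p q" and d: "decomposable S r q"
    and u[measurable]: "u \<in> borel_measurable \<Lambda>"
  shows "\<exists>G. AE y in density \<Lambda> T.marginal. T.full u y = G (r y)"
proof -
  obtain pD plocal where D: "\<And>x y. x \<in> S \<Longrightarrow> y \<in> S \<Longrightarrow> q x y = pD x (r y) * plocal (r y) y"
    using d by (auto simp: decomposable_def)
  have q_measurable[measurable]: "(\<lambda>(x, y). q x y) \<in> borel_measurable (\<Lambda> \<Otimes>\<^sub>M \<Lambda>)"
    using q by (simp add: density_version_def density_kernel_def)
  define G where "G z = (\<integral>x. \<rho>0 x * pD x z * u x \<partial>\<Lambda>) / (\<integral>x. \<rho>0 x * pD x z \<partial>\<Lambda>)" for z
  have "AE x in \<Lambda>. AE y in \<Lambda>. \<rho>0 x * q x y = \<rho>0 x * p x y"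
    using q by (simp add: density_version_iff)
  then have "AE y in \<Lambda>. AE x in \<Lambda>. \<rho>0 x * q x y = \<rho>0 x * p x y"
    by (subst \<Lambda>\<Lambda>.AE_commute[symmetric]) auto
  then have "AE y in \<Lambda>. 0 < \<rho>\<^sub>1 y \<longrightarrow> T.full u y = G (r y)"
    using AE_space
  proof eventually_elim
    case (elim y)
    then have y: "y \<in> S" by simp
    have [measurable]: "(\<lambda>x. p x y) \<in> borel_measurable \<Lambda>" "(\<lambda>x. q x y) \<in> borel_measurable \<Lambda>"
      using section_measurable(2)[OF p_measurable] section_measurable(2)[OF q_measurable] y by auto
    show ?case
    proof
      assume pos: "0 < \<rho>\<^sub>1 y"
      define c where "c = plocal (r y) y"
      have weighted: "(\<integral>x. \<rho>0 x * p x y * v x \<partial>\<Lambda>) = c * (\<integral>x. \<rho>0 x * pD x (r y) * v x \<partial>\<Lambda>)"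
        if [measurable]: "v \<in> borel_measurable \<Lambda>" for v
      proof -
        have "(\<integral>x. \<rho>0 x * p x y * v x \<partial>\<Lambda>) = (\<integral>x. \<rho>0 x * q x y * v x \<partial>\<Lambda>)"
          using elim(1) by (intro integral_cong_AE) (auto elim!: eventually_mono)
        also have "\<dots> = (\<integral>x. c * (\<rho>0 x * pD x (r y) * v x) \<partial>\<Lambda>)"
          using y by (intro Bochner_Integration.integral_cong) (auto simp: D c_def)
        finally show ?thesis by simp
      qed
      have \<rho>1_eq: "\<rho>\<^sub>1 y = c * (\<integral>x. \<rho>0 x * pD x (r y) \<partial>\<Lambda>)"
        using weighted[of "\<lambda>_. 1"] by (simp add: \<rho>1_def)
      have "T.full u y = (\<integral>x. \<rho>0 x * p x y * u x \<partial>\<Lambda>) / \<rho>\<^sub>1 y"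
        by (simp add: T.full_def T_marginal)
      also have "\<dots> = G (r y)"
        using pos by (auto simp: weighted \<rho>1_eq G_def)
      finally show "T.full u y = G (r y)" .
    qed
  qed
  then have "AE y in density \<Lambda> T.marginal. T.full u y = G (r y)"
    unfolding T_marginal using T.marginal_measurable by (simp add: AE_density_iff T_marginal)
  then show ?thesis by blast
qed

lemma lumpable_if_full_eq_reduced:
  assumes "\<And>A. A \<in> sets \<Lambda> \<Longrightarrow>
    AE x in density \<Lambda> K.marginal. K.reduced (indicator A) x = K.full (indicator A) x"
  shows "\<exists>q. density_version S \<rho>0 p q \<and> lumpable S r q"
proof -
  obtain k where k[measurable]: "(\<lambda>(z, y). k z y) \<in> borel_measurable (borel \<Otimes>\<^sub>M \<Lambda>)"
    and k_nonneg: "\<And>z y. 0 \<le> k z y"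
    and eq: "AE q in \<Lambda> \<Otimes>\<^sub>M \<Lambda>. \<rho>0 (fst q) * p (fst q) (snd q) =
      K.marginal (fst q) * (k (r (fst q)) (snd q) * K.marginal' (snd q))"
    using K.density_factorizes[OF assms] by blast
  have [measurable]: "\<rho>\<^sub>1 \<in> borel_measurable \<Lambda>"
    using \<rho>1_density by (simp add: prob_density_def)
  have \<rho>1_nonneg: "0 \<le> \<rho>\<^sub>1 y" if "y \<in> S" for y
    using \<rho>1_density that by (simp add: prob_density_def)
  define n where "n z \<longleftrightarrow> (\<integral>\<^sup>+y. ennreal (k z y * \<rho>\<^sub>1 y) \<partial>\<Lambda>) = 1" for z
  \<comment> \<open>Whether \<open>k (r x) y * \<rho>\<^sub>1 y\<close> is normalized depends on \<open>x\<close> only through \<open>r x\<close>.\<close>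
  define pL where "pL z y = (if n z then k z y * \<rho>\<^sub>1 y else \<rho>\<^sub>1 y)" for z y
  have "AE x in \<Lambda>. AE y in \<Lambda>. \<rho>0 x * p x y = \<rho>0 x * (k (r x) y * \<rho>\<^sub>1 y)"
    using \<Lambda>\<Lambda>.AE_pair[OF eq] AE_space
    by eventually_elim (simp add: K_marginal K_marginal')
  then have "density_version S \<rho>0 p (\<lambda>x y. pL (r x) y)"
    unfolding pL_def n_def
    by (intro normalized_density_version) (auto simp: k_nonneg \<rho>1_nonneg)
  moreover have "lumpable S r (\<lambda>x y. pL (r x) y)"
    unfolding lumpable_def by (rule exI[of _ pL]) (auto simp: pL_def k_nonneg \<rho>1_nonneg)
  ultimately show ?thesis by blast
qed

lemma decomposable_if_full_eq_reduced:
  assumes "\<And>A. A \<in> sets \<Lambda> \<Longrightarrow>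
    AE y in density \<Lambda> T.marginal. T.reduced (indicator A) y = T.full (indicator A) y"
  shows "\<exists>q. density_version S \<rho>0 p q \<and> decomposable S r q"
proof -
  obtain k where k[measurable]: "(\<lambda>(z, x). k z x) \<in> borel_measurable (borel \<Otimes>\<^sub>M \<Lambda>)"
    and k_nonneg: "\<And>z x. 0 \<le> k z x"
    and eq: "AE q in \<Lambda> \<Otimes>\<^sub>M \<Lambda>. \<rho>0 (snd q) * p (snd q) (fst q) =
      T.marginal (fst q) * (k (r (fst q)) (snd q) * T.marginal' (snd q))"
    using T.density_factorizes[OF assms] by blast
  have [measurable]: "\<rho>\<^sub>1 \<in> borel_measurable \<Lambda>"
    using \<rho>1_density by (simp add: prob_density_def)
  have \<rho>1_nonneg: "0 \<le> \<rho>\<^sub>1 y" if "y \<in> S" for y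
    using \<rho>1_density that by (simp add: prob_density_def)
  define n where "n x \<longleftrightarrow> (\<integral>\<^sup>+y. ennreal (k (r y) x * \<rho>\<^sub>1 y) \<partial>\<Lambda>) = 1" for x
  \<comment> \<open>With the constant value 1 of \<open>pD x\<close>, the product with the local factor \<open>\<rho>\<^sub>1\<close> is \<open>\<rho>\<^sub>1\<close> itself.\<close>
  define pD where "pD x z = (if n x then k z x else 1)" for x z
  have "AE y in \<Lambda>. AE x in \<Lambda>. \<rho>0 x * p x y = \<rho>0 x * (k (r y) x * \<rho>\<^sub>1 y)"
    using \<Lambda>\<Lambda>.AE_pair[OF eq]
  proof eventually_elim
    case (elim y)
    then show ?case
      using AE_space by eventually_elim (simp add: T_marginal T_marginal' ac_simps)
  qed
  then have "AE x in \<Lambda>. AE y in \<Lambda>. \<rho>0 x * p x y = \<rho>0 x * (k (r y) x * \<rho>\<^sub>1 y)"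
    by (subst \<Lambda>\<Lambda>.AE_commute) auto
  then have "density_version S \<rho>0 p
      (\<lambda>x y. if (\<integral>\<^sup>+y. ennreal (k (r y) x * \<rho>\<^sub>1 y) \<partial>\<Lambda>) = 1 then k (r y) x * \<rho>\<^sub>1 y else \<rho>\<^sub>1 y)"
    by (intro normalized_density_version) (auto simp: k_nonneg \<rho>1_nonneg)
  also have "(\<lambda>x y. if (\<integral>\<^sup>+y. ennreal (k (r y) x * \<rho>\<^sub>1 y) \<partial>\<Lambda>) = 1 then k (r y) x * \<rho>\<^sub>1 y else \<rho>\<^sub>1 y) =
      (\<lambda>x y. pD x (r y) * \<rho>\<^sub>1 y)"
    by (auto simp: pD_def n_def fun_eq_iff)
  finally have "density_version S \<rho>0 p (\<lambda>x y. pD x (r y) * \<rho>\<^sub>1 y)" .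
  moreover have "decomposable S r (\<lambda>x y. pD x (r y) * \<rho>\<^sub>1 y)"
    unfolding decomposable_def
    by (rule exI[of _ pD], rule exI[of _ "\<lambda>_. \<rho>\<^sub>1"]) (auto simp: pD_def k_nonneg \<rho>1_nonneg)
  ultimately show ?thesis by blast
qed

theorem lumpable_iff_koopman_L_eq_koopman:
  "(\<exists>q. density_version S \<rho>0 p q \<and> lumpable S r q) \<longleftrightarrow>
    operators_equal S \<rho>0 (L_infinity S) (koopman_L S \<rho>0 p r) (koopman S p)"
  unfolding koopman_equal_iff
proof (intro iffI ballI)
  fix f assume "\<exists>q. density_version S \<rho>0 p q \<and> lumpable S r q" and "f \<in> L_infinity S"
  note f = integrable_L_infinity[OF \<open>f \<in> L_infinity S\<close>]
  obtain G where G: "AE x in density \<Lambda> K.marginal. K.full f x = G (r x)"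
    using lumpable_imp_full_factors[OF _ _ f(1)] \<open>\<exists>q. _ q\<close> by blast
  obtain G' where "G' \<in> borel_measurable borel" "AE x in density \<Lambda> K.marginal. K.full f x = G' (r x)"
    by (rule composition_has_borel_factor[OF S r K.full_measurable[OF f(1)] _ G]) auto
  then show "AE x in density \<Lambda> K.marginal. K.reduced f x = K.full f x"
    by (rule K.reduced_eq_full[OF f])
next
  assume "\<forall>f\<in>L_infinity S. AE x in density \<Lambda> K.marginal. K.reduced f x = K.full f x"
  then show "\<exists>q. density_version S \<rho>0 p q \<and> lumpable S r q"
    by (intro lumpable_if_full_eq_reduced) (blast intro: indicator_in_L_infinity)
qed

theorem decomposable_iff_perron_frobenius_D_eq_perron_frobenius:
  "(\<exists>q. density_version S \<rho>0 p q \<and> decomposable S r q) \<longleftrightarrow>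
    operators_equal S \<rho>\<^sub>1 (L1_weighted S \<rho>0) (perron_frobenius_D S \<rho>0 p r) (perron_frobenius S \<rho>0 p)"
  unfolding perron_frobenius_equal_iff
proof (intro iffI ballI)
  fix u assume "\<exists>q. density_version S \<rho>0 p q \<and> decomposable S r q" and "u \<in> L1_weighted S \<rho>0"
  note u = integrable_L1_weighted[OF \<open>u \<in> L1_weighted S \<rho>0\<close>]
  obtain G where G: "AE y in density \<Lambda> T.marginal. T.full u y = G (r y)"
    using decomposable_imp_full_factors[OF _ _ u(1)] \<open>\<exists>q. _ q\<close> by blast
  obtain G' where "G' \<in> borel_measurable borel" "AE y in density \<Lambda> T.marginal. T.full u y = G' (r y)"
    by (rule composition_has_borel_factor[OF S r T.full_measurable[OF u(1)] _ G]) auto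
  then show "AE y in density \<Lambda> T.marginal. T.reduced u y = T.full u y"
    by (rule T.reduced_eq_full[OF u])
next
  assume "\<forall>u\<in>L1_weighted S \<rho>0. AE y in density \<Lambda> T.marginal. T.reduced u y = T.full u y"
  then show "\<exists>q. density_version S \<rho>0 p q \<and> decomposable S r q"
    by (intro decomposable_if_full_eq_reduced) (blast intro: indicator_in_L1_weighted)
qed

end

lemma continuously_differentiable_on_imp_continuous_on:
  "continuously_differentiable_on r S \<Longrightarrow> continuous_on S r"
  unfolding continuously_differentiable_on_def
  by (meson continuous_on_eq_continuous_within has_derivative_continuous)

theorem lemma5p2:
  fixes M :: "'w measure"
    and S :: "(real ^ 'D) set"
    and X :: "real \<Rightarrow> 'w \<Rightarrow> real ^ 'D"
    and \<tau> t :: real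
    and p :: "real ^ 'D \<Rightarrow> real ^ 'D \<Rightarrow> real"
    and \<rho>0 :: "real ^ 'D \<Rightarrow> real"
    and r :: "real ^ 'D \<Rightarrow> real ^ 'd"
  assumes "S \<in> sets lebesgue"
    and "markov_process M S X"
    and "0 < \<tau>"
    and "has_transition_density M S X \<tau> p"
    and "0 \<le> t"
    and "has_marginal_density M S (X t) \<rho>0"
    and "reaction_coordinate S r"
  shows "((\<exists>q. density_version S \<rho>0 p q \<and> lumpable S r q) \<longleftrightarrow>
            operators_equal S \<rho>0 (L_infinity S) (koopman_L S \<rho>0 p r) (koopman S p)) \<and>
         ((\<exists>q. density_version S \<rho>0 p q \<and> decomposable S r q) \<longleftrightarrow>
            operators_equal S (\<rho>1 S \<rho>0 p) (L1_weighted S \<rho>0)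
              (perron_frobenius_D S \<rho>0 p r) (perron_frobenius S \<rho>0 p))"
proof -
  interpret transition S r \<rho>0 p
    using assms continuously_differentiable_on_imp_continuous_on
    by unfold_locales
      (auto simp: has_transition_density_def has_marginal_density_def reaction_coordinate_def)
  show ?thesis
    using lumpable_iff_koopman_L_eq_koopman
      decomposable_iff_perron_frobenius_D_eq_perron_frobenius by blast
qed

end
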